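(* For every positive integer $n$, let $T(n)$ denote the maximum number of transversals in a Latin square of order $n$. Then \[ T(n) \geq \left((1-o(1))\frac{n}{e^2}\right)^{n}, \] where $o(1)$ denotes a quantity tending to $0$ as $n\to\infty$.
   Context: A Latin square of order $n$ is an $n\times n$ matrix with entries from an alphabet of $n$ symbols in which every symbol appears exactly once in every row and every column. A transversal of a Latin square of order $n$ is a set of $n$ entries containing exactly one entry from each row, exactly one from each column, and exactly one of each symbol. *)

theory Defs
  imports Complex_Main
begin

(* A matrix of order n is a function whose values matter only on {..<n} x {..<n};
   the alphabet A is a parameter, so that the symbols need not be the row indices. *)
definition latin_square :: "nat \<Rightarrow> 'a set \<Rightarrow> (nat \<Rightarrow> nat \<Rightarrow> 'a) \<Rightarrow> bool" where
  "latin_square n A L \<longleftrightarrow>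
     finite A \<and> card A = n \<and>
     (\<forall>i<n. \<forall>j<n. L i j \<in> A) \<and>
     (\<forall>i<n. \<forall>s\<in>A. \<exists>!j. j < n \<and> L i j = s) \<and>
     (\<forall>j<n. \<forall>s\<in>A. \<exists>!i. i < n \<and> L i j = s)"

(* An entry is identified with its cell (row, column). *)
definition transversal :: "nat \<Rightarrow> 'a set \<Rightarrow> (nat \<Rightarrow> nat \<Rightarrow> 'a) \<Rightarrow> (nat \<times> nat) set \<Rightarrow> bool" where
  "transversal n A L X \<longleftrightarrow>
     X \<subseteq> {..<n} \<times> {..<n} \<and> card X = n \<and>
     (\<forall>i<n. \<exists>!p. p \<in> X \<and> fst p = i) \<and>
     (\<forall>j<n. \<exists>!p. p \<in> X \<and> snd p = j) \<and>
     (\<forall>s\<in>A. \<exists>!p. p \<in> X \<and> L (fst p) (snd p) = s)"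

definition num_transversals :: "nat \<Rightarrow> 'a set \<Rightarrow> (nat \<Rightarrow> nat \<Rightarrow> 'a) \<Rightarrow> nat" where
  "num_transversals n A L = card {X. transversal n A L X}"

definition transversal_counts :: "nat \<Rightarrow> nat set" where
  "transversal_counts n =
     {num_transversals n A L | (A :: nat set) (L :: nat \<Rightarrow> nat \<Rightarrow> nat). latin_square n A L}"

(* Renaming symbols does not change the number of transversals, so alphabets
   consisting of natural numbers lose no generality. *)
definition T :: "nat \<Rightarrow> nat" where
  "T n = Max (transversal_counts n)"

(* The next two lemmas show that the maximum in the definition of T is attained. *)
lemma finite_transversal_counts: "finite (transversal_counts n)"
proof -
  have "num_transversals n A L \<le> card (Pow ({..<n} \<times> {..<n}))"
    for A :: "nat set" and L :: "nat \<Rightarrow> nat \<Rightarrow> nat"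
    unfolding num_transversals_def
    by (rule card_mono) (auto simp: transversal_def)
  then have "transversal_counts n \<subseteq> {..card (Pow ({..<n} \<times> {..<n}))}"
    unfolding transversal_counts_def by blast
  then show ?thesis
    by (rule finite_subset) simp
qed

lemma transversal_counts_nonempty: "transversal_counts n \<noteq> {}"
proof -
  have uniq: "\<exists>!j. j < n \<and> (i + j) mod n = s" if "i < n" "s < n" for i s
  proof (rule ex1I[where a = "if i \<le> s then s - i else n + s - i"])
    show "(if i \<le> s then s - i else n + s - i) < n
        \<and> (i + (if i \<le> s then s - i else n + s - i)) mod n = s"
      using that by auto
  next
    fix j assume j: "j < n \<and> (i + j) mod n = s"
    show "j = (if i \<le> s then s - i else n + s - i)"
    proof (cases "i + j < n")
      case True
      then show ?thesis using j by auto
    next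
      case False
      then have "(i + j) mod n = i + j - n"
        using that(1) conjunct1[OF j] by (simp add: le_mod_geq)
      then show ?thesis using j that False by auto
    qed
  qed
  have "latin_square n {..<n} (\<lambda>i j. (i + j) mod n)"
    unfolding latin_square_def using uniq by (auto simp: add.commute)
  then show ?thesis
    unfolding transversal_counts_def by blast
qed

end

theory Submission
  imports Defs "HOL-Combinatorics.Permutations" "HOL-Library.FuncSet" "HOL-Number_Theory.Cong"
    "HOL-Real_Asymp.Real_Asymp"
begin

text \<open>
  Fix an even \<open>k\<close> and a Latin square \<open>M\<close> of order \<open>k\<close> with a transversal \<open>\<tau>\<close>. For odd \<open>t\<close> put
  \<open>m = (k - 1) t\<close> and replace every entry of \<open>M\<close> by an \<open>m \<times> m\<close> block: the blocks on \<open>\<tau>\<close> are copies of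
  \<open>\<int>/m\<close>, the other \<open>k (k - 1)\<close> blocks are independent random isotopic copies of \<open>\<int>/m\<close>.
  Consider the candidate transversals that take exactly \<open>t\<close> entries from each block off \<open>\<tau>\<close> and none
  from the blocks on \<open>\<tau>\<close>; there are \<open>m!\<^sup>3\<^sup>k / t!\<^sup>k\<^sup>(\<^sup>k\<^sup>-\<^sup>1\<^sup>)\<close> of them. In a random block, \<open>t\<close> prescribed
  entries in general position occur with probability at least \<open>((m - 2t) / m\<^sup>2)\<^sup>t\<close>, and \<open>t / m = 1 / (k - 1)\<close> is
  small. Averaging yields a square of order \<open>N = k m\<close> with about \<open>((1 - 3 / k) N / e\<^sup>2)\<^sup>N\<close> transversals.
  Since \<open>m\<close> is odd, the blocks on \<open>\<tau>\<close> contain \<open>m\<close> disjoint transversals of the whole square, all of them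
  disjoint from the candidates. Prolonging along \<open>r\<close> of them, with a corner square of order \<open>r\<close> that
  has a transversal, reaches every large order \<open>n = N + r\<close> with \<open>r\<close> bounded in terms of \<open>k\<close>, without
  losing any candidate. Finally \<open>k\<close> tends to infinity.
\<close>

subsection \<open>Latin squares as sets of triples\<close>

text \<open>
  A Latin square is encoded as an orthogonal array: its set of triples (row, column, symbol). This makes
  the three roles symmetric. A transversal of \<open>L\<close> is a \<open>diagonal\<close> that is a subset of \<open>L\<close>.
\<close>

definition latin :: "'a set \<Rightarrow> 'b set \<Rightarrow> 'c set \<Rightarrow> ('a \<times> 'b \<times> 'c) set \<Rightarrow> bool" where
  "latin R C S L \<longleftrightarrow> L \<subseteq> R \<times> C \<times> S \<and>
     (\<forall>r\<in>R. \<forall>c\<in>C. \<exists>s. (r, c, s) \<in> L) \<and>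
     (\<forall>r\<in>R. \<forall>s\<in>S. \<exists>c. (r, c, s) \<in> L) \<and>
     (\<forall>c\<in>C. \<forall>s\<in>S. \<exists>r. (r, c, s) \<in> L) \<and>
     (\<forall>r c s s'. (r, c, s) \<in> L \<longrightarrow> (r, c, s') \<in> L \<longrightarrow> s = s') \<and>
     (\<forall>r c c' s. (r, c, s) \<in> L \<longrightarrow> (r, c', s) \<in> L \<longrightarrow> c = c') \<and>
     (\<forall>r r' c s. (r, c, s) \<in> L \<longrightarrow> (r', c, s) \<in> L \<longrightarrow> r = r')"

definition diagonal :: "'a set \<Rightarrow> 'b set \<Rightarrow> 'c set \<Rightarrow> ('a \<times> 'b \<times> 'c) set \<Rightarrow> bool" where
  "diagonal R C S X \<longleftrightarrow> X \<subseteq> R \<times> C \<times> S \<and>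
     (\<forall>r\<in>R. \<exists>c s. (r, c, s) \<in> X) \<and>
     (\<forall>c\<in>C. \<exists>r s. (r, c, s) \<in> X) \<and>
     (\<forall>s\<in>S. \<exists>r c. (r, c, s) \<in> X) \<and>
     (\<forall>r c c' s s'. (r, c, s) \<in> X \<longrightarrow> (r, c', s') \<in> X \<longrightarrow> c = c' \<and> s = s') \<and>
     (\<forall>r r' c s s'. (r, c, s) \<in> X \<longrightarrow> (r', c, s') \<in> X \<longrightarrow> r = r' \<and> s = s') \<and>
     (\<forall>r r' c c' s. (r, c, s) \<in> X \<longrightarrow> (r', c', s) \<in> X \<longrightarrow> r = r' \<and> c = c')"

subsection \<open>Prolongation\<close>

text \<open>
  The entry \<open>(r, c, s)\<close> of the transversal \<open>\<tau> d\<close> is replaced by the three entries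
  \<open>(r, c, d)\<close>, \<open>(r, d, s)\<close> and \<open>(d, c, s)\<close>; the square \<open>K\<close> fills the corner.
\<close>

fun prolong_mem ::
  "('a \<times> 'b \<times> 'c) set \<Rightarrow> 'd set \<Rightarrow> ('d \<Rightarrow> ('a \<times> 'b \<times> 'c) set) \<Rightarrow> ('d \<times> 'd \<times> 'd) set \<Rightarrow>
     ('a + 'd) \<times> ('b + 'd) \<times> ('c + 'd) \<Rightarrow> bool" where
  "prolong_mem L D \<tau> K (Inl r, Inl c, Inl s) \<longleftrightarrow> (r, c, s) \<in> L \<and> (\<forall>d\<in>D. (r, c, s) \<notin> \<tau> d)"
| "prolong_mem L D \<tau> K (Inl r, Inl c, Inr d) \<longleftrightarrow> d \<in> D \<and> (\<exists>s. (r, c, s) \<in> \<tau> d)"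
| "prolong_mem L D \<tau> K (Inl r, Inr d, Inl s) \<longleftrightarrow> d \<in> D \<and> (\<exists>c. (r, c, s) \<in> \<tau> d)"
| "prolong_mem L D \<tau> K (Inr d, Inl c, Inl s) \<longleftrightarrow> d \<in> D \<and> (\<exists>r. (r, c, s) \<in> \<tau> d)"
| "prolong_mem L D \<tau> K (Inr x, Inr y, Inr z) \<longleftrightarrow> (x, y, z) \<in> K"
| "prolong_mem L D \<tau> K (Inl r, Inr y, Inr z) \<longleftrightarrow> False"
| "prolong_mem L D \<tau> K (Inr x, Inl c, Inr z) \<longleftrightarrow> False"
| "prolong_mem L D \<tau> K (Inr x, Inr y, Inl s) \<longleftrightarrow> False"

definition prolong where "prolong L D \<tau> K = {p. prolong_mem L D \<tau> K p}"

lemma in_prolong [simp]: "p \<in> prolong L D \<tau> K \<longleftrightarrow> prolong_mem L D \<tau> K p"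
  by (simp add: prolong_def)

lemma ball_Plus: "(\<forall>x\<in>A <+> B. P x) \<longleftrightarrow> (\<forall>a\<in>A. P (Inl a)) \<and> (\<forall>b\<in>B. P (Inr b))"
  by auto

lemma all_sum: "(\<forall>x. P x) \<longleftrightarrow> (\<forall>a. P (Inl a)) \<and> (\<forall>b. P (Inr b))"
  by (metis sum.exhaust)

lemma ex_sum: "(\<exists>x. P x) \<longleftrightarrow> (\<exists>a. P (Inl a)) \<or> (\<exists>b. P (Inr b))"
  by (metis sum.exhaust)

lemma latinD:
  assumes "latin R C S L"
  shows "\<And>r c s. (r, c, s) \<in> L \<Longrightarrow> r \<in> R \<and> c \<in> C \<and> s \<in> S"
    and "\<And>r c. r \<in> R \<Longrightarrow> c \<in> C \<Longrightarrow> \<exists>s. (r, c, s) \<in> L"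
    and "\<And>r s. r \<in> R \<Longrightarrow> s \<in> S \<Longrightarrow> \<exists>c. (r, c, s) \<in> L"
    and "\<And>c s. c \<in> C \<Longrightarrow> s \<in> S \<Longrightarrow> \<exists>r. (r, c, s) \<in> L"
    and "\<And>r c s s'. (r, c, s) \<in> L \<Longrightarrow> (r, c, s') \<in> L \<Longrightarrow> s = s'"
    and "\<And>r c c' s. (r, c, s) \<in> L \<Longrightarrow> (r, c', s) \<in> L \<Longrightarrow> c = c'"
    and "\<And>r r' c s. (r, c, s) \<in> L \<Longrightarrow> (r', c, s) \<in> L \<Longrightarrow> r = r'"
  using assms unfolding latin_def by (blast, blast, blast, blast, blast, blast, blast)

lemma diagonalD:
  assumes "diagonal R C S X"
  shows "\<And>r c s. (r, c, s) \<in> X \<Longrightarrow> r \<in> R \<and> c \<in> C \<and> s \<in> S"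
    and "\<And>r. r \<in> R \<Longrightarrow> \<exists>c s. (r, c, s) \<in> X"
    and "\<And>c. c \<in> C \<Longrightarrow> \<exists>r s. (r, c, s) \<in> X"
    and "\<And>s. s \<in> S \<Longrightarrow> \<exists>r c. (r, c, s) \<in> X"
    and "\<And>r c c' s s'. (r, c, s) \<in> X \<Longrightarrow> (r, c', s') \<in> X \<Longrightarrow> c = c' \<and> s = s'"
    and "\<And>r r' c s s'. (r, c, s) \<in> X \<Longrightarrow> (r', c, s') \<in> X \<Longrightarrow> r = r' \<and> s = s'"
    and "\<And>r r' c c' s. (r, c, s) \<in> X \<Longrightarrow> (r', c', s) \<in> X \<Longrightarrow> r = r' \<and> c = c'"
  using assms unfolding diagonal_def by (blast, blast, blast, blast, blast, blast, blast)

text \<open>Since the \<open>\<tau> d\<close> are disjoint, a replaced entry is replaced for exactly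
  one \<open>d\<close>. Since each \<open>\<tau> d\<close> meets every old row, column and symbol
  once, it fills each new line outside the corner exactly once.\<close>

lemma latin_prolong:
  assumes L: "latin R C S L" and K: "latin D D D K"
    and \<tau>: "\<And>d. d \<in> D \<Longrightarrow> \<tau> d \<subseteq> L" "\<And>d. d \<in> D \<Longrightarrow> diagonal R C S (\<tau> d)"
    and disj: "\<And>d d'. d \<in> D \<Longrightarrow> d' \<in> D \<Longrightarrow> d \<noteq> d' \<Longrightarrow> \<tau> d \<inter> \<tau> d' = {}"
  shows "latin (R <+> D) (C <+> D) (S <+> D) (prolong L D \<tau> K)"
proof -
  note L' = latinD[OF L] and K' = latinD[OF K] and \<tau>' = diagonalD[OF \<tau>(2)]
  have \<tau>L: "p \<in> L" if "d \<in> D" "p \<in> \<tau> d" for d p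
    using that \<tau>(1) by blast
  have disj': "d = d'" if "p \<in> \<tau> d" "p \<in> \<tau> d'" "d \<in> D" "d' \<in> D" for d d' p
    using that disj by blast
  have sub: "\<forall>x y z. (x, y, z) \<in> prolong L D \<tau> K \<longrightarrow> x \<in> R <+> D \<and> y \<in> C <+> D \<and> z \<in> S <+> D"
    unfolding all_sum in_prolong prolong_mem.simps
    using L'(1) K'(1) \<tau>'(1) by (auto; blast)
  \<comment> \<open>The delicate cases complete an old pair once by an old and once by a new
    element, or by two new ones. Both triples come from entries of \<open>L\<close> that agree in
    two coordinates and so coincide; then the removal of \<open>\<tau> d\<close>, or disjointness,
    decides.\<close>
  have uniq: "\<And>x y z z'. (x, y, z) \<in> prolong L D \<tau> K \<Longrightarrow> (x, y, z') \<in> prolong L D \<tau> K \<Longrightarrow> z = z'"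
    "\<And>x y y' z. (x, y, z) \<in> prolong L D \<tau> K \<Longrightarrow> (x, y', z) \<in> prolong L D \<tau> K \<Longrightarrow> y = y'"
    "\<And>x x' y z. (x, y, z) \<in> prolong L D \<tau> K \<Longrightarrow> (x', y, z) \<in> prolong L D \<tau> K \<Longrightarrow> x = x'"
    subgoal for x y z z'
      by (cases x; cases y; cases z; cases z'; simp; (elim conjE exE)?; (elim conjE exE)?; blast dest: L'(5-7) K'(5-7) \<tau>'(5-7) \<tau>L disj')
    subgoal for x y y' z
      by (cases x; cases y; cases z; cases y'; simp; (elim conjE exE)?; (elim conjE exE)?; blast dest: L'(5-7) K'(5-7) \<tau>'(5-7) \<tau>L disj')
    subgoal for x x' y z
      by (cases x; cases y; cases z; cases x'; simp; (elim conjE exE)?; (elim conjE exE)?; blast dest: L'(5-7) K'(5-7) \<tau>'(5-7) \<tau>L disj')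
    done
  have ex1: "\<forall>x\<in>R <+> D. \<forall>y\<in>C <+> D. \<exists>z. (x, y, z) \<in> prolong L D \<tau> K"
    unfolding ball_Plus ex_sum in_prolong prolong_mem.simps
    using L'(2) K'(2) \<tau>'(2,3) by (intro conjI ballI) (blast, blast, blast, blast)
  have ex2: "\<forall>x\<in>R <+> D. \<forall>z\<in>S <+> D. \<exists>y. (x, y, z) \<in> prolong L D \<tau> K"
    unfolding ball_Plus ex_sum in_prolong prolong_mem.simps
    using L'(3) K'(3) \<tau>'(2,4) by (intro conjI ballI) (blast, blast, blast, blast)
  have ex3: "\<forall>y\<in>C <+> D. \<forall>z\<in>S <+> D. \<exists>x. (x, y, z) \<in> prolong L D \<tau> K"
    unfolding ball_Plus ex_sum in_prolong prolong_mem.simps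
    using L'(4) K'(4) \<tau>'(3,4) by (intro conjI ballI) (blast, blast, blast, blast)
  have sub': "prolong L D \<tau> K \<subseteq> (R <+> D) \<times> (C <+> D) \<times> (S <+> D)"
    using sub by (simp del: in_prolong add: subset_iff)
  show ?thesis
    unfolding latin_def
    by (intro conjI allI impI) (rule sub' ex1 ex2 ex3 | erule (1) uniq)+
qed

text \<open>\<open>X\<close> avoids all replaced entries, so it survives in the old part, while
  \<open>Y\<close> serves the new rows, columns and symbols inside the corner.\<close>

lemma diagonal_prolong:
  assumes "diagonal R C S X" "X \<subseteq> L" "\<And>d. d \<in> D \<Longrightarrow> \<tau> d \<inter> X = {}"
    and "diagonal D D D Y" "Y \<subseteq> K"
  defines "Z \<equiv> (\<lambda>(r, c, s). (Inl r, Inl c, Inl s)) ` X \<union> (\<lambda>(x, y, z). (Inr x, Inr y, Inr z)) ` Y"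
  shows "diagonal (R <+> D) (C <+> D) (S <+> D) Z" "Z \<subseteq> prolong L D \<tau> K"
proof -
  have *: "(Inl r, Inl c, Inl s) \<in> Z \<longleftrightarrow> (r, c, s) \<in> X" "(Inr x, Inr y, Inr z) \<in> Z \<longleftrightarrow> (x, y, z) \<in> Y"
    for r c s x y z unfolding Z_def by force+
  show "Z \<subseteq> prolong L D \<tau> K" using assms(2,3,5) unfolding Z_def by (auto; blast)
  have sub: "Z \<subseteq> (R <+> D) \<times> (C <+> D) \<times> (S <+> D)"
    using assms(1,4) unfolding Z_def diagonal_def by auto
  note X = diagonalD[OF assms(1)] and Y = diagonalD[OF assms(4)]
  show "diagonal (R <+> D) (C <+> D) (S <+> D) Z"
    unfolding diagonal_def
  proof (intro conjI sub allI impI, goal_cases)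
    case 1 show ?case unfolding ball_Plus ex_sum * using X(2) Y(2) by blast
  next
    case 2 show ?case unfolding ball_Plus ex_sum * using X(3) Y(3) by blast
  next
    case 3 show ?case unfolding ball_Plus ex_sum * using X(4) Y(4) by blast
  qed (auto simp: Z_def dest: X(5-7) Y(5-7))
qed

subsection \<open>Relabelling\<close>

lemma bij_betw_facts:
  assumes "bij_betw f A B"
  shows "\<And>x. x \<in> A \<Longrightarrow> f x \<in> B" "\<And>y. y \<in> B \<Longrightarrow> \<exists>x\<in>A. f x = y"
    "\<And>x x'. f x = f x' \<Longrightarrow> x \<in> A \<Longrightarrow> x' \<in> A \<Longrightarrow> x = x'"
  using assms unfolding bij_betw_def inj_on_def by auto

lemma latin_relabel:
  assumes f: "bij_betw f R R'" and g: "bij_betw g C C'" and h: "bij_betw h S S'"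
    and L: "latin R C S L"
  shows "latin R' C' S' (map_prod f (map_prod g h) ` L)"
proof -
  note L = latinD[OF L] and f = bij_betw_facts[OF f] and g = bij_betw_facts[OF g] and h = bij_betw_facts[OF h]
  show ?thesis
    unfolding latin_def
  proof (intro conjI allI impI ballI, goal_cases)
    case 1 show ?case using L(1) f(1) g(1) h(1) by (auto dest: L(1))
  next
    case (2 r c) then show ?case using f(2)[of r] g(2)[of c] L(2) by force
  next
    case (3 r s) then show ?case using f(2)[of r] h(2)[of s] L(3) by force
  next
    case (4 c s) then show ?case using g(2)[of c] h(2)[of s] L(4) by force
  next
    case (5 r c s s') then show ?case by clarsimp (metis L(1,5) f(3) g(3))
  next
    case (6 r c c' s) then show ?case by clarsimp (metis L(1,6) f(3) h(3))
  next
    case (7 r r' c s) then show ?case by clarsimp (metis L(1,7) g(3) h(3))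
  qed
qed

lemma diagonal_relabel:
  assumes f: "bij_betw f R R'" and g: "bij_betw g C C'" and h: "bij_betw h S S'"
    and X: "diagonal R C S X"
  shows "diagonal R' C' S' (map_prod f (map_prod g h) ` X)"
proof -
  note X = diagonalD[OF X] and f = bij_betw_facts[OF f] and g = bij_betw_facts[OF g] and h = bij_betw_facts[OF h]
  show ?thesis
    unfolding diagonal_def
  proof (intro allI impI ballI conjI, goal_cases)
    case 1 show ?case using f(1) g(1) h(1) by (auto dest: X(1))
  next
    case (2 r) then show ?case using f(2)[of r] X(2) by force
  next
    case (3 c) then show ?case using g(2)[of c] X(3) by force
  next
    case (4 s) then show ?case using h(2)[of s] X(4) by force
  next
    case (5 r c c' s s') then show ?case by clarsimp (metis X(1,5) f(3))
  next
    case (6 r c c' s s') then show ?case by clarsimp (metis X(1,5) f(3))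
  next
    case (7 r r' c s s') then show ?case by clarsimp (metis X(1,6) g(3))
  next
    case (8 r r' c s s') then show ?case by clarsimp (metis X(1,6) g(3))
  next
    case (9 r r' c c' s) then show ?case by clarsimp (metis X(1,7) h(3))
  next
    case (10 r r' c c' s) then show ?case by clarsimp (metis X(1,7) h(3))
  qed
qed

section \<open>From sets of triples back to matrices and \<open>T\<close>\<close>

text \<open>\<open>L\<close> gives each cell one symbol, so a subset of \<open>L\<close> can be
  recovered from its cells. Passing to sets of cells, as \<open>transversal\<close> requires,
  therefore identifies no two members of \<open>\<X>\<close>.\<close>

lemma T_ge_square:
  assumes L: "latin {..<n} {..<n} {..<n} L"
    and XX: "\<And>X. X \<in> \<X> \<Longrightarrow> X \<subseteq> L \<and> diagonal {..<n} {..<n} {..<n} X"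
  shows "card \<X> \<le> T n"
proof -
  note L' = latinD[OF L]
  define M where "M i j = (THE s. (i, j, s) \<in> L)" for i j
  have M: "M i j = s" if "(i, j, s) \<in> L" for i j s
    unfolding M_def using that L'(5) by blast
  have M_in: "(i, j, M i j) \<in> L" if "i < n" "j < n" for i j
    using L'(2)[of i j] that M by force
  have ls: "latin_square n {..<n} M"
    unfolding latin_square_def
  proof (intro conjI allI ballI impI, goal_cases)
    case (3 i j) then show ?case using M_in L'(1) by blast
  next
    case (4 i s)
    then obtain j where j: "(i, j, s) \<in> L" using L'(3) by blast
    show ?case
    proof (rule ex1I[of _ j])
      show "j < n \<and> M i j = s" using j L'(1) M by blast
      show "j' = j" if "j' < n \<and> M i j' = s" for j' using that M_in[of i j'] 4(1) j L'(6) by blast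
    qed
  next
    case (5 j s)
    then obtain i where i: "(i, j, s) \<in> L" using L'(4) by blast
    show ?case
    proof (rule ex1I[of _ i])
      show "i < n \<and> M i j = s" using i L'(1) M by blast
      show "i' = i" if "i' < n \<and> M i' j = s" for i' using that M_in[of i' j] 5(1) i L'(7) by blast
    qed
  qed auto
  define cells :: "(nat \<times> nat \<times> nat) set \<Rightarrow> _" where "cells X = (\<lambda>(r, c, s). (r, c)) ` X" for X
  have tr: "transversal n {..<n} M (cells X)" if X: "X \<in> \<X>" for X
  proof -
    have XL: "X \<subseteq> L" and "diagonal {..<n} {..<n} {..<n} X" using XX[OF X] by auto
    note D = diagonalD[OF this(2)]
    have inX: "(i, j) \<in> cells X \<longleftrightarrow> (i, j, M i j) \<in> X" for i j
      unfolding cells_def using XL M by force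
    have MX: "M i j = s" if "(i, j, s) \<in> X" for i j s using that XL M by blast
    have cellI: "(r, c) \<in> cells X" if "(r, c, s) \<in> X" for r c s
      using that MX[OF that] inX[of r c] by simp
    have sub: "cells X \<subseteq> {..<n} \<times> {..<n}" unfolding cells_def using D(1) by fast
    moreover have "bij_betw fst (cells X) {..<n}"
      unfolding bij_betw_def
    proof
      show "inj_on fst (cells X)" by (rule inj_onI) (metis D(5) inX prod.collapse)
      show "fst ` cells X = {..<n}"
      proof
        show "fst ` cells X \<subseteq> {..<n}" using sub by auto
        show "{..<n} \<subseteq> fst ` cells X" using D(2) cellI by (metis fst_conv image_eqI subsetI)
      qed
    qed
    then have "card (cells X) = n" using bij_betw_same_card[of fst "cells X" "{..<n}"] by simp
    ultimately show ?thesis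
      unfolding transversal_def
    proof (intro conjI allI ballI impI, goal_cases)
      case (3 i)
      then obtain c s where X: "(i, c, s) \<in> X" using D(2) by blast
      show ?case
      proof (rule ex1I[of _ "(i, c)"])
        show "(i, c) \<in> cells X \<and> fst (i, c) = i" using cellI[OF X] MX[OF X] by simp
        show "p = (i, c)" if "p \<in> cells X \<and> fst p = i" for p
        proof -
          have "(fst p, snd p) \<in> cells X" using that by (metis prod.collapse)
          then have "(fst p, snd p, M (fst p) (snd p)) \<in> X" using inX by blast
          then show ?thesis using that X D(5) by (metis prod.collapse)
        qed
      qed
    next
      case (4 j)
      then obtain r s where X: "(r, j, s) \<in> X" using D(3) by blast
      show ?case
      proof (rule ex1I[of _ "(r, j)"])
        show "(r, j) \<in> cells X \<and> snd (r, j) = j" using cellI[OF X] MX[OF X] by simp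
        show "p = (r, j)" if "p \<in> cells X \<and> snd p = j" for p
        proof -
          have "(fst p, snd p) \<in> cells X" using that by (metis prod.collapse)
          then have "(fst p, snd p, M (fst p) (snd p)) \<in> X" using inX by blast
          then show ?thesis using that X D(6) by (metis prod.collapse)
        qed
      qed
    next
      case (5 s)
      then obtain r c where X: "(r, c, s) \<in> X" using D(4) by blast
      show ?case
      proof (rule ex1I[of _ "(r, c)"])
        show "(r, c) \<in> cells X \<and> M (fst (r, c)) (snd (r, c)) = s" using cellI[OF X] MX[OF X] by simp
        show "p = (r, c)" if "p \<in> cells X \<and> M (fst p) (snd p) = s" for p
        proof -
          have "(fst p, snd p) \<in> cells X" using that by (metis prod.collapse)
          then have "(fst p, snd p, M (fst p) (snd p)) \<in> X" using inX by blast
          then show ?thesis using that X D(7) by (metis prod.collapse)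
        qed
      qed
    qed auto
  qed
  have inj: "inj_on cells \<X>"
  proof (rule inj_onI)
    fix X Y assume "X \<in> \<X>" "Y \<in> \<X>" and eq: "cells X = cells Y"
    then have "X \<subseteq> L" "Y \<subseteq> L" using XX by auto
    have uncell: "(\<lambda>(i, j). (i, j, M i j)) ` cells Z = Z" if "Z \<subseteq> L" for Z
    proof -
      have "(\<lambda>(i, j). (i, j, M i j)) ` cells Z = (\<lambda>z. z) ` Z"
        unfolding cells_def image_image using that M by (intro image_cong) auto
      then show ?thesis by simp
    qed
    show "X = Y" using uncell[OF \<open>X \<subseteq> L\<close>] uncell[OF \<open>Y \<subseteq> L\<close>] unfolding eq by (rule trans[OF sym])
  qed
  have fin: "finite {X. transversal n {..<n} M X}"
    by (rule finite_subset[of _ "Pow ({..<n} \<times> {..<n})"]) (auto simp: transversal_def)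
  have "card \<X> \<le> num_transversals n {..<n} M"
    unfolding num_transversals_def using inj fin tr by (intro card_inj_on_le[of cells]) auto
  also have "\<dots> \<le> T n"
    unfolding T_def using ls finite_transversal_counts
    by (intro Max_ge) (auto simp: transversal_counts_def)
  finally show ?thesis .
qed

text \<open>This allows the constructions below to index lines by pairs and by disjoint sums: a
  relabelling is injective on triples, hence on sets of triples.\<close>

lemma T_ge:
  assumes fin: "finite R" "finite C" "finite S" and card: "card R = n" "card C = n" "card S = n"
    and L: "latin R C S L"
    and XX: "\<And>X. X \<in> \<X> \<Longrightarrow> X \<subseteq> L \<and> diagonal R C S X"
  shows "card \<X> \<le> T n"
proof -
  obtain f g h where f: "bij_betw f R {..<n}" and g: "bij_betw g C {..<n}" and h: "bij_betw h S {..<n}"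
    using finite_same_card_bij[of R "{..<n}"] finite_same_card_bij[of C "{..<n}"]
      finite_same_card_bij[of S "{..<n}"] fin card by auto
  define \<phi> where "\<phi> = map_prod f (map_prod g h)"
  have "inj_on \<phi> (R \<times> C \<times> S)"
    unfolding \<phi>_def using f g h by (intro map_prod_inj_on) (auto simp: bij_betw_def)
  moreover have "\<X> \<subseteq> Pow (R \<times> C \<times> S)" using XX unfolding diagonal_def by blast
  ultimately have inj: "inj_on (image \<phi>) \<X>"
    by (meson inj_on_image_Pow inj_on_subset)
  have "card (image \<phi> ` \<X>) \<le> T n"
  proof (rule T_ge_square[of n "\<phi> ` L"])
    show "latin {..<n} {..<n} {..<n} (\<phi> ` L)"
      unfolding \<phi>_def by (rule latin_relabel[OF f g h L])
    show "Y \<subseteq> \<phi> ` L \<and> diagonal {..<n} {..<n} {..<n} Y" if "Y \<in> image \<phi> ` \<X>" for Y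
      using that XX diagonal_relabel[OF f g h] unfolding \<phi>_def by blast
  qed
  then show ?thesis using card_image[OF inj] by simp
qed

subsection \<open>Cyclic squares\<close>

text \<open>The Cayley table of \<int>/m with rows permuted by \<open>fst w\<close> and symbols by
  \<open>snd w\<close>. These two permutations are the whole randomness of a block.\<close>

definition block :: "nat \<Rightarrow> (nat \<Rightarrow> nat) \<times> (nat \<Rightarrow> nat) \<Rightarrow> (nat \<times> nat \<times> nat) set" where
  "block m w = {(a, b, c). a < m \<and> b < m \<and> c = snd w ((fst w a + b) mod m)}"

lemma mod_add_cancel_nat:
  fixes x y z m :: nat
  assumes "(x + y) mod m = (x + z) mod m" "y < m" "z < m"
  shows "y = z"
  using assms cong_add_lcancel_nat[of x y z m] by (simp add: Cong.cong_def)

lemma latin_block: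
  assumes \<alpha>: "fst w permutes {..<m}" and \<gamma>: "snd w permutes {..<m}"
  shows "latin {..<m} {..<m} {..<m} (block m w)"
proof -
  have \<alpha>m: "fst w a < m \<longleftrightarrow> a < m" and \<gamma>m: "snd w a < m \<longleftrightarrow> a < m" for a
    using permutes_in_image[OF \<alpha>, of a] permutes_in_image[OF \<gamma>, of a] by auto
  have \<alpha>s: "\<exists>a. fst w a = x" and \<gamma>s: "\<exists>a. snd w a = x" for x
    using permutes_surj[OF \<alpha>] permutes_surj[OF \<gamma>] by (metis surjD)+
  \<comment> \<open>Adding \<open>m\<close> before subtracting \<open>x\<close> keeps the difference
    of natural numbers from being truncated.\<close>
  have sol: "(x + (d + m - x) mod m) mod m = d" if "x < m" "d < m" for x d
    using that by (simp add: mod_simps)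
  show ?thesis
    unfolding latin_def
  proof (intro conjI allI impI ballI, goal_cases)
    case 1 show ?case by (auto simp: block_def \<gamma>m)
  next
    case (2 r c) then show ?case by (auto simp: block_def)
  next
    case (3 r s)
    obtain d where d: "snd w d = s" using \<gamma>s by blast
    then have "d < m" using 3 \<gamma>m by auto
    then show ?case using 3 d sol[of "fst w r" d]
      by (intro exI[of _ "(d + m - fst w r) mod m"]) (auto simp: block_def \<alpha>m)
  next
    case (4 c s)
    obtain d where d: "snd w d = s" using \<gamma>s by blast
    obtain r where r: "fst w r = (d + m - c) mod m" using \<alpha>s by blast
    have "d < m" using 4 d \<gamma>m by auto
    moreover have "r < m" using r 4 \<alpha>m[of r] by auto
    ultimately show ?case using 4 d r sol[of c d]
      by (intro exI[of _ r]) (auto simp: block_def add.commute)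
  next
    case (5 r c s s') then show ?case by (auto simp: block_def)
  next
    case (6 r c c' s)
    then have "(fst w r + c) mod m = (fst w r + c') mod m" "c < m" "c' < m"
      by (auto simp: block_def inj_eq[OF permutes_inj[OF \<gamma>]])
    then show ?case using mod_add_cancel_nat by blast
  next
    case (7 r r' c s)
    then have "(c + fst w r) mod m = (c + fst w r') mod m" "fst w r < m" "fst w r' < m"
      by (auto simp: block_def inj_eq[OF permutes_inj[OF \<gamma>]] \<alpha>m add.commute)
    then show ?case using mod_add_cancel_nat permutes_inj[OF \<alpha>] by (metis injD)
  qed
qed

text \<open>The cells where column minus row is \<open>x\<close> modulo \<open>m\<close>; the symbol
  there in the addition table is \<open>a + (a + x)\<close>.\<close>

definition cyclic_diagonal :: "nat \<Rightarrow> nat \<Rightarrow> (nat \<times> nat \<times> nat) set" where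
  "cyclic_diagonal m x = (\<lambda>a. (a, (a + x) mod m, (2 * a + x) mod m)) ` {..<m}"

lemma cyclic_diagonal_subset: "cyclic_diagonal m x \<subseteq> block m (id, id)"
  by (auto simp: cyclic_diagonal_def block_def mod_simps add.assoc mult_2)

lemma cyclic_diagonal_disjoint:
  assumes "x < m" "y < m" "x \<noteq> y"
  shows "cyclic_diagonal m x \<inter> cyclic_diagonal m y = {}"
  using assms by (auto simp: cyclic_diagonal_def dest: mod_add_cancel_nat)

text \<open>The columns are a shift of the rows. The symbols are distinct because 2 is invertible
  modulo an odd \<open>m\<close>.\<close>

lemma diagonal_cyclic_diagonal:
  assumes "odd m"
  shows "diagonal {..<m} {..<m} {..<m} (cyclic_diagonal m x)"
proof -
  have m: "m > 0" using assms by (cases m) auto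
  have inj1: "inj_on (\<lambda>a. (a + x) mod m) {..<m}"
    by (rule inj_onI) (metis mod_add_cancel_nat add.commute lessThan_iff)
  have inj2: "inj_on (\<lambda>a. (2 * a + x) mod m) {..<m}"
  proof (rule inj_onI)
    fix a b assume ab: "a \<in> {..<m}" "b \<in> {..<m}" "(2 * a + x) mod m = (2 * b + x) mod m"
    then have "[2 * a = 2 * b] (mod m)"
      using cong_add_rcancel_nat[of "2 * a" x "2 * b" m] by (simp add: Cong.cong_def)
    then have "[a = b] (mod m)" using assms cong_mult_lcancel_nat[of 2 m a b] by simp
    then show "a = b" using ab by (simp add: Cong.cong_def)
  qed
  have sur: "f ` {..<m} = {..<m}" if "inj_on f {..<m}" "\<And>a. f a < m" for f
    using that by (intro endo_inj_surj) auto
  have s1: "\<exists>a<m. (a + x) mod m = c" and s2: "\<exists>a<m. (2 * a + x) mod m = c" if "c < m" for c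
  proof -
    have "c \<in> (\<lambda>a. (a + x) mod m) ` {..<m}" "c \<in> (\<lambda>a. (2 * a + x) mod m) ` {..<m}"
      using sur[OF inj1] sur[OF inj2] m that by simp_all
    then show "\<exists>a<m. (a + x) mod m = c" "\<exists>a<m. (2 * a + x) mod m = c" by auto
  qed
  show ?thesis
    unfolding diagonal_def
  proof (intro allI impI ballI conjI, goal_cases)
    case 1 show ?case using m by (auto simp: cyclic_diagonal_def)
  next
    case (2 r) then show ?case by (auto simp: cyclic_diagonal_def)
  next
    case (3 c) then show ?case using s1[of c] by (force simp: cyclic_diagonal_def)
  next
    case (4 c) then show ?case using s2[of c] by (force simp: cyclic_diagonal_def)
  qed (auto simp: cyclic_diagonal_def dest: inj_onD[OF inj1] inj_onD[OF inj2])
qed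

text \<open>For odd \<open>n\<close> the cyclic square works. For even \<open>n\<close>, prolong the
  cyclic square of order \<open>n - 1\<close> along the diagonal with shift 1 and a corner of order
  1; the diagonal with shift 0 is disjoint from it and extends by the corner entry. A square of
  order 2 has no transversal.\<close>

lemma latin_with_diagonal:
  assumes "n \<ge> 3"
  shows "\<exists>L X :: (nat \<times> nat \<times> nat) set. latin {..<n} {..<n} {..<n} L \<and> X \<subseteq> L \<and> diagonal {..<n} {..<n} {..<n} X"
proof (cases "odd n")
  case True
  then show ?thesis
    using latin_block[of "(id, id)" n] cyclic_diagonal_subset diagonal_cyclic_diagonal[OF True]
    by (intro exI[of _ "block n (id, id)"] exI[of _ "cyclic_diagonal n 0"]) (auto simp: permutes_id)
next
  case False
  define m where "m = n - 1"
  have m: "odd m" "m \<ge> 2" "n = Suc m" using False assms by (auto simp: m_def)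
  let ?R = "{..<m} <+> {0 :: nat}" and ?K = "{(0 :: nat, 0 :: nat, 0 :: nat)}"
  let ?L = "prolong (block m (id, id)) {0 :: nat} (\<lambda>_. cyclic_diagonal m 1) ?K"
  have K: "latin {0} {0} {0} ?K" "diagonal {0} {0} {0} ?K"
    by (auto simp: latin_def diagonal_def)
  have L: "latin ?R ?R ?R ?L"
    using m K(1) cyclic_diagonal_subset latin_block[of "(id, id)" m] diagonal_cyclic_diagonal
    by (intro latin_prolong) (auto simp: permutes_id)
  have "cyclic_diagonal m 1 \<inter> cyclic_diagonal m 0 = {}"
    using cyclic_diagonal_disjoint[of 1 m 0] m(2) by simp
  note * = diagonal_prolong[OF diagonal_cyclic_diagonal[OF m(1), of 0] cyclic_diagonal_subset this K(2) subset_refl]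
  obtain X where X: "diagonal ?R ?R ?R X" "X \<subseteq> ?L"
    using that[OF *(1) *(2)] by simp
  have "card ?R = n" "finite ?R" using m by (auto simp: card_Plus)
  then obtain f where f: "bij_betw f ?R {..<n}"
    using finite_same_card_bij[of ?R "{..<n}"] by auto
  show ?thesis
    by (intro exI conjI) (rule latin_relabel[OF f f f L], rule image_mono[OF X(2)], rule diagonal_relabel[OF f f f X(1)])
qed

subsection \<open>Replacing entries by blocks\<close>

definition inflate :: "('i \<times> 'j \<times> 'k) set \<Rightarrow> ('i \<times> 'j \<times> 'k \<Rightarrow> ('a \<times> 'b \<times> 'c) set) \<Rightarrow>
    (('i \<times> 'a) \<times> ('j \<times> 'b) \<times> ('k \<times> 'c)) set" where
  "inflate M \<omega> = {((i, a), (j, b), (k, c)) | i j k a b c. (i, j, k) \<in> M \<and> (a, b, c) \<in> \<omega> (i, j, k)}"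

lemma in_inflate [simp]:
  "((i, a), (j, b), (k, c)) \<in> inflate M \<omega> \<longleftrightarrow> (i, j, k) \<in> M \<and> (a, b, c) \<in> \<omega> (i, j, k)"
  by (simp add: inflate_def)

lemma inflate_mono:
  assumes "M \<subseteq> M'" and "\<And>\<beta>. \<beta> \<in> M \<Longrightarrow> \<omega> \<beta> \<subseteq> \<omega>' \<beta>"
  shows "inflate M \<omega> \<subseteq> inflate M' \<omega>'"
  unfolding inflate_def using assms by blast

lemma latin_inflate:
  assumes M: "latin I J K M" and \<omega>: "\<And>\<beta>. \<beta> \<in> M \<Longrightarrow> latin A B C (\<omega> \<beta>)"
  shows "latin (I \<times> A) (J \<times> B) (K \<times> C) (inflate M \<omega>)"
proof -
  note M = latinD[OF M] and \<omega> = latinD[OF \<omega>]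
  show ?thesis
    unfolding latin_def split_paired_All
  proof (intro conjI allI impI ballI, goal_cases)
    case 1 show ?case by (auto simp: inflate_def dest: M(1) \<omega>(1))
  next
    case (2 r c) then show ?case using M(2) \<omega>(2) by (cases r; cases c) (simp; blast)
  next
    case (3 r c) then show ?case using M(3) \<omega>(3) by (cases r; cases c) (simp; blast)
  next
    case (4 r c) then show ?case using M(4) \<omega>(4) by (cases r; cases c) (simp; blast)
  next
    case 5 then show ?case using M(5) \<omega>(5) by (simp; metis)
  next
    case 6 then show ?case using M(6) \<omega>(6) by (simp; metis)
  next
    case 7 then show ?case using M(7) \<omega>(7) by (simp; metis)
  qed
qed

text \<open>Applied to a coarse transversal and cyclic diagonals, this gives transversals of the
  large square supported on the blocks of that transversal.\<close>

lemma diagonal_inflate: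
  assumes M: "diagonal I J K M" and \<omega>: "\<And>\<beta>. \<beta> \<in> M \<Longrightarrow> diagonal A B C (\<omega> \<beta>)"
  shows "diagonal (I \<times> A) (J \<times> B) (K \<times> C) (inflate M \<omega>)"
proof -
  note M = diagonalD[OF M] and \<omega> = diagonalD[OF \<omega>]
  show ?thesis
    unfolding diagonal_def split_paired_All
  proof (intro allI impI ballI conjI, goal_cases)
    case 1 show ?case by (auto simp: inflate_def dest: M(1) \<omega>(1))
  next
    case (2 r) then show ?case using M(2) \<omega>(2) by (cases r) (simp; blast)
  next
    case (3 r) then show ?case using M(3) \<omega>(3) by (cases r) (simp; blast)
  next
    case (4 r) then show ?case using M(4) \<omega>(4) by (cases r) (simp; blast)
  qed (simp_all, metis M(5) \<omega>(5), metis M(5) \<omega>(5), metis M(6) \<omega>(6), metis M(6) \<omega>(6), metis M(7) \<omega>(7), metis M(7) \<omega>(7))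
qed

subsection \<open>Counting\<close>

lemma card_le_fibres:
  assumes "finite A" and "\<And>y. y \<in> f ` A \<Longrightarrow> card {x \<in> A. f x = y} \<le> c"
  shows "card A \<le> card (f ` A) * c"
proof -
  have "A = (\<Union>y\<in>f ` A. {x \<in> A. f x = y})" by blast
  then have "card A = card (\<Union>y\<in>f ` A. {x \<in> A. f x = y})" by simp
  also have "\<dots> \<le> (\<Sum>y\<in>f ` A. card {x \<in> A. f x = y})"
    using assms(1) by (intro card_UN_le) simp
  also have "\<dots> \<le> (\<Sum>y\<in>f ` A. c)"
    by (rule sum_mono) (rule assms(2))
  finally show ?thesis by simp
qed

lemma card_filter_eq_sum:
  assumes "finite A"
  shows "card {x \<in> A. P x} = (\<Sum>x\<in>A. if P x then 1 else 0)"
  using assms by (simp add: sum.If_cases Int_def)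

text \<open>Double counting of the pairs with \<open>good \<omega> x\<close>. The quotient
  \<open>p / q\<close> is a lower bound for a probability, cleared of denominators to stay in the
  natural numbers.\<close>

lemma exists_average:
  fixes p q :: nat
  assumes fin: "finite \<Omega>" "finite X" and ne: "\<Omega> \<noteq> {}"
    and le: "\<And>x. x \<in> X \<Longrightarrow> p * card \<Omega> \<le> q * card {\<omega> \<in> \<Omega>. good \<omega> x}"
  shows "\<exists>\<omega>\<in>\<Omega>. p * card X \<le> q * card {x \<in> X. good \<omega> x}"
proof (rule ccontr)
  assume "\<not> ?thesis"
  then have "(\<Sum>\<omega>\<in>\<Omega>. q * card {x \<in> X. good \<omega> x}) < (\<Sum>\<omega>\<in>\<Omega>. p * card X)"
    using fin ne by (intro sum_strict_mono) auto
  also have "\<dots> = (\<Sum>x\<in>X. p * card \<Omega>)" by simp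
  also have "\<dots> \<le> (\<Sum>x\<in>X. q * card {\<omega> \<in> \<Omega>. good \<omega> x})"
    by (rule sum_mono) (rule le)
  also have "\<dots> = q * (\<Sum>x\<in>X. \<Sum>\<omega>\<in>\<Omega>. if good \<omega> x then 1 else 0)"
    by (simp only: sum_distrib_left card_filter_eq_sum[OF fin(1)])
  also have "\<dots> = q * (\<Sum>\<omega>\<in>\<Omega>. \<Sum>x\<in>X. if good \<omega> x then 1 else 0)"
    by (subst sum.swap) simp
  also have "\<dots> = (\<Sum>\<omega>\<in>\<Omega>. q * card {x \<in> X. good \<omega> x})"
    by (simp only: sum_distrib_left card_filter_eq_sum[OF fin(2)])
  finally show False by simp
qed

text \<open>The values of a uniformly random function at different points are independent, so the
  bounds \<open>a / q\<close> for single points multiply.\<close>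

lemma card_PiE_filter:
  fixes a q :: nat
  assumes "finite B" and le: "\<And>\<beta>. \<beta> \<in> B \<Longrightarrow> a * card P \<le> q * card {w \<in> P. g \<beta> w}"
  shows "a ^ card B * card (B \<rightarrow>\<^sub>E P) \<le> q ^ card B * card {\<omega> \<in> B \<rightarrow>\<^sub>E P. \<forall>\<beta>\<in>B. g \<beta> (\<omega> \<beta>)}"
proof -
  have "{\<omega> \<in> B \<rightarrow>\<^sub>E P. \<forall>\<beta>\<in>B. g \<beta> (\<omega> \<beta>)} = PiE B (\<lambda>\<beta>. {w \<in> P. g \<beta> w})"
    by (auto simp: PiE_iff extensional_def)
  then have "q ^ card B * card {\<omega> \<in> B \<rightarrow>\<^sub>E P. \<forall>\<beta>\<in>B. g \<beta> (\<omega> \<beta>)} = (\<Prod>\<beta>\<in>B. q * card {w \<in> P. g \<beta> w})"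
    using assms(1) by (simp add: card_PiE prod.distrib)
  also have "(\<Prod>\<beta>\<in>B. a * card P) \<le> \<dots>"
    by (rule prod_mono) (use le in auto)
  finally show ?thesis using assms(1) by (simp add: card_PiE power_mult_distrib)
qed

section \<open>Probability that a random block contains prescribed entries\<close>

lemma card_permutes_extending:
  assumes S: "finite S" and f: "inj_on f A" "f ` A \<subseteq> S" and g: "inj_on g A" "g ` A \<subseteq> S"
  shows "fact (card S - card A) \<le> card {\<pi>. \<pi> permutes S \<and> (\<forall>a\<in>A. \<pi> (f a) = g a)}"
proof -
  have card: "card (S - f ` A) = card S - card A" "card (S - g ` A) = card S - card A"
    using f g S by (simp_all add: card_Diff_subset finite_subset card_image)
  then obtain h where h: "bij_betw h (S - f ` A) (S - g ` A)"
    using S finite_same_card_bij[of "S - f ` A" "S - g ` A"] by auto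
  define \<pi>0 where "\<pi>0 x = (if x \<in> f ` A then g (the_inv_into A f x) else if x \<in> S then h x else x)" for x
  have \<pi>0: "\<pi>0 (f a) = g a" if "a \<in> A" for a
    using that f(1) by (simp add: \<pi>0_def the_inv_into_f_f)
  have "bij_betw \<pi>0 (f ` A) (g ` A)"
    unfolding bij_betw_def
  proof
    show "inj_on \<pi>0 (f ` A)"
      by (rule inj_onI) (metis (no_types, lifting) \<pi>0 g(1) imageE inj_onD)
    show "\<pi>0 ` f ` A = g ` A" using \<pi>0 by (simp add: image_image)
  qed
  moreover have "bij_betw \<pi>0 (S - f ` A) (S - g ` A)"
    using h by (rule bij_betw_cong[THEN iffD1, rotated]) (auto simp: \<pi>0_def)
  ultimately have "bij_betw \<pi>0 (f ` A \<union> (S - f ` A)) (g ` A \<union> (S - g ` A))"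
    by (rule bij_betw_combine) auto
  then have "bij_betw \<pi>0 S S" using f(2) g(2) by (simp add: Un_absorb1)
  then have \<pi>0_perm: "\<pi>0 permutes S"
    by (rule bij_imp_permutes) (use f(2) in \<open>auto simp: \<pi>0_def\<close>)
  have "card {\<sigma>. \<sigma> permutes (S - f ` A)} \<le> card {\<pi>. \<pi> permutes S \<and> (\<forall>a\<in>A. \<pi> (f a) = g a)}"
  proof (rule card_inj_on_le)
    show "inj_on (\<lambda>\<sigma>. \<pi>0 \<circ> \<sigma>) {\<sigma>. \<sigma> permutes (S - f ` A)}"
      by (auto simp: inj_on_def fun_eq_iff inj_eq[OF permutes_inj[OF \<pi>0_perm]])
    show "(\<lambda>\<sigma>. \<pi>0 \<circ> \<sigma>) ` {\<sigma>. \<sigma> permutes (S - f ` A)} \<subseteq> {\<pi>. \<pi> permutes S \<and> (\<forall>a\<in>A. \<pi> (f a) = g a)}"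
    proof clarify
      fix \<sigma> assume \<sigma>: "\<sigma> permutes (S - f ` A)"
      have "\<sigma> (f a) = f a" if "a \<in> A" for a
        using permutes_not_in[OF \<sigma>, of "f a"] that by simp
      then show "(\<pi>0 \<circ> \<sigma>) permutes S \<and> (\<forall>a\<in>A. (\<pi>0 \<circ> \<sigma>) (f a) = g a)"
        using \<pi>0 permutes_subset[OF \<sigma>, of S] \<pi>0_perm by (auto intro: permutes_compose)
    qed
    show "finite {\<pi>. \<pi> permutes S \<and> (\<forall>a\<in>A. \<pi> (f a) = g a)}"
      by (rule finite_subset[OF _ finite_permutations[OF S]]) auto
  qed
  then show ?thesis using card_permutations[OF card(1)] S by simp
qed

lemma card_injective_funcset:
  assumes "finite A" "card A = t"
  shows "card {f \<in> {..<t} \<rightarrow>\<^sub>E A. inj_on f {..<t}} = fact t"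
proof -
  have "card {f \<in> {..<t} \<rightarrow>\<^sub>E A. inj_on f {..<t}} = prod ((-) t) {0..<t}"
    using card_inj_on_subset_funcset[of "{..<t}" A "{..<t}"] assms by simp
  then show ?thesis by (simp add: fact_prod_rev)
qed

text \<open>Greedy choice: each of the \<open>t\<close> values in turn has to avoid at most
  \<open>2 * t\<close> elements.\<close>

lemma card_shifted_injections:
  assumes "\<And>l. l < t \<Longrightarrow> b l < m"
  defines "G \<equiv> \<lambda>s. {u \<in> {..<s} \<rightarrow>\<^sub>E {..<m}. inj_on u {..<s} \<and> inj_on (\<lambda>l. (u l + b l) mod m) {..<s}}"
  shows "(m - 2 * t) ^ t \<le> card (G t)"
proof -
  have fin: "finite (G s)" for s
    unfolding G_def by (rule finite_subset[of _ "{..<s} \<rightarrow>\<^sub>E {..<m}"]) (auto intro: finite_PiE)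
  have "(m - 2 * t) ^ s \<le> card (G s)" if "s \<le> t" for s
    using that
  proof (induction s)
    case 0
    have "G 0 = {\<lambda>_. undefined}" by (auto simp: G_def)
    then show ?case by simp
  next
    case (Suc s)
    \<comment> \<open>The values excluded at \<open>s\<close>: those already taken, and those whose
      shift by \<open>b s\<close> collides with an earlier shifted value.\<close>
    define bad where "bad u = u ` {..<s} \<union> {x \<in> {..<m}. (x + b s) mod m \<in> (\<lambda>l. (u l + b l) mod m) ` {..<s}}" for u
    have bad: "card (bad u) \<le> 2 * t" if "u \<in> G s" for u
    proof -
      have "card {x \<in> {..<m}. (x + b s) mod m \<in> (\<lambda>l. (u l + b l) mod m) ` {..<s}} \<le> card ((\<lambda>l. (u l + b l) mod m) ` {..<s})"
      proof (rule card_inj_on_le[where f = "\<lambda>x. (x + b s) mod m"])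
        show "inj_on (\<lambda>x. (x + b s) mod m) {x \<in> {..<m}. (x + b s) mod m \<in> (\<lambda>l. (u l + b l) mod m) ` {..<s}}"
          by (rule inj_onI) (metis (no_types, lifting) mod_add_cancel_nat add.commute lessThan_iff mem_Collect_eq)
      qed auto
      also have "\<dots> \<le> s" using card_image_le[of "{..<s}"] by force
      finally show ?thesis
        unfolding bad_def using card_Un_le[of "u ` {..<s}"] card_image_le[of "{..<s}" u] Suc.prems
        by (smt (verit) add_le_mono card_lessThan finite_lessThan le_trans mult_2 Suc_leD)
    qed
    have "(m - 2 * t) ^ Suc s \<le> (m - 2 * t) * card (G s)"
      using Suc by simp
    also have "\<dots> = (\<Sum>u\<in>G s. m - 2 * t)" by simp
    also have "\<dots> \<le> (\<Sum>u\<in>G s. card ({..<m} - bad u))"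
    proof (rule sum_mono)
      fix u assume u: "u \<in> G s"
      have "card {..<m} - card (bad u) \<le> card ({..<m} - bad u)"
        by (rule diff_card_le_card_Diff) (auto simp: bad_def)
      then show "m - 2 * t \<le> card ({..<m} - bad u)" using bad[OF u] by simp
    qed
    also have "\<dots> = card (Sigma (G s) (\<lambda>u. {..<m} - bad u))"
      using fin by (subst card_SigmaI) auto
    also have "\<dots> \<le> card (G (Suc s))"
    proof (rule card_inj_on_le[where f = "\<lambda>(u, x). u(s := x)"])
      show "inj_on (\<lambda>(u, x). u(s := x)) (Sigma (G s) (\<lambda>u. {..<m} - bad u))"
      proof (rule inj_onI, clarify)
        fix u x v y assume uv: "u \<in> G s" "v \<in> G s" and eq: "u(s := x) = v(s := y)"
        have "u l = v l" for l
          using uv fun_cong[OF eq, of l] by (cases "l = s") (auto simp: G_def PiE_iff extensional_def)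
        then show "u = v \<and> x = y" using fun_cong[OF eq, of s] by auto
      qed
      show "(\<lambda>(u, x). u(s := x)) ` Sigma (G s) (\<lambda>u. {..<m} - bad u) \<subseteq> G (Suc s)"
      proof clarify
        fix u x assume u: "u \<in> G s" and x: "x < m" "x \<notin> bad u"
        have 1: "u(s := x) \<in> {..<Suc s} \<rightarrow>\<^sub>E {..<m}"
          using u x by (auto simp: G_def lessThan_Suc PiE_iff extensional_def)
        have 2: "inj_on (u(s := x)) {..<Suc s}"
          using u x by (auto simp: G_def bad_def lessThan_Suc inj_on_def)
        have "(x + b s) mod m \<noteq> (u l + b l) mod m" if "l < s" for l
          using x that by (force simp: bad_def)
        then have 3: "inj_on (\<lambda>l. ((u(s := x)) l + b l) mod m) {..<Suc s}"
          using u by (auto simp: G_def lessThan_Suc inj_on_def) metis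
        show "u(s := x) \<in> G (Suc s)" unfolding G_def using 1 2 3 by blast
      qed
    qed (rule fin)
    finally show ?case .
  qed
  then show ?thesis by simp
qed

text \<open>Split by the images \<open>u l\<close> of the rows \<open>r l\<close> under the first
  permutation. For each of the at least \<open>(m - 2 * t) ^ t\<close> choices of \<open>u\<close>
  with distinct \<open>u l\<close> and distinct sums \<open>u l + c l\<close> modulo
  \<open>m\<close>, each permutation has \<open>t\<close> prescribed values, leaving at least
  \<open>fact (m - t)\<close> options.\<close>

lemma card_block_extending:
  assumes r: "inj_on r {..<t}" "r ` {..<t} \<subseteq> {..<m}" and c: "c ` {..<t} \<subseteq> {..<m}"
    and s: "inj_on s {..<t}" "s ` {..<t} \<subseteq> {..<m}"
  defines "P \<equiv> {\<alpha>. \<alpha> permutes {..<m}} \<times> {\<gamma>. \<gamma> permutes {..<m}}"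
  shows "(m - 2 * t) ^ t * card P
    \<le> m ^ (2 * t) * card {w \<in> P. \<forall>l<t. snd w ((fst w (r l) + c l) mod m) = s l}"
    (is "_ \<le> _ * card ?W")
proof -
  have tm: "t \<le> m" using card_mono[OF _ r(2)] card_image[OF r(1)] by simp
  define G where "G = {u \<in> {..<t} \<rightarrow>\<^sub>E {..<m}. inj_on u {..<t} \<and> inj_on (\<lambda>l. (u l + c l) mod m) {..<t}}"
  have G: "(m - 2 * t) ^ t \<le> card G"
    unfolding G_def by (rule card_shifted_injections) (use c in auto)
  have finG: "finite G"
    unfolding G_def by (rule finite_subset[of _ "{..<t} \<rightarrow>\<^sub>E {..<m}"]) (auto intro: finite_PiE)
  define A where "A u = {\<alpha>. \<alpha> permutes {..<m} \<and> (\<forall>l\<in>{..<t}. \<alpha> (r l) = u l)}" for u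
  define B where "B u = {\<gamma>. \<gamma> permutes {..<m} \<and> (\<forall>l\<in>{..<t}. \<gamma> ((u l + c l) mod m) = s l)}" for u
  have finAB: "finite (A u \<times> B u)" for u
    unfolding A_def B_def
    by (intro finite_cartesian_product; rule finite_subset[OF _ finite_permutations[of "{..<m}"]]) auto
  have AB: "fact (m - t) * fact (m - t) \<le> card (A u \<times> B u)" if "u \<in> G" for u
  proof -
    have u: "inj_on u {..<t}" "u ` {..<t} \<subseteq> {..<m}" "inj_on (\<lambda>l. (u l + c l) mod m) {..<t}"
      using that by (auto simp: G_def)
    have "(\<lambda>l. (u l + c l) mod m) ` {..<t} \<subseteq> {..<m}" using tm by auto
    from card_permutes_extending[OF _ u(3) this s] card_permutes_extending[OF _ r u(1,2)]
    have "fact (m - t) \<le> card (A u)" "fact (m - t) \<le> card (B u)"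
      by (simp_all add: A_def B_def)
    then show ?thesis unfolding card_cartesian_product by (rule mult_le_mono)
  qed
  have "(m - 2 * t) ^ t * (fact (m - t) * fact (m - t)) \<le> (\<Sum>u\<in>G. fact (m - t) * fact (m - t))"
    using G by simp
  also have "\<dots> \<le> (\<Sum>u\<in>G. card (A u \<times> B u))"
    by (rule sum_mono) (rule AB)
  also have "\<dots> = card (Sigma G (\<lambda>u. A u \<times> B u))"
    using finG finAB by (subst card_SigmaI) auto
  also have "\<dots> \<le> card ?W"
  \<comment> \<open>The sets for different \<open>u\<close> are disjoint, since the first
    permutation determines \<open>u\<close> through its values at the \<open>r l\<close>.\<close>
  proof (rule card_inj_on_le[where f = snd])
    show "inj_on snd (Sigma G (\<lambda>u. A u \<times> B u))"
    proof (rule inj_onI)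
      fix p q assume p: "p \<in> Sigma G (\<lambda>u. A u \<times> B u)" and q: "q \<in> Sigma G (\<lambda>u. A u \<times> B u)"
        and eq: "snd p = snd q"
      have SigmaD: "fst z \<in> G \<and> snd z \<in> A (fst z) \<times> B (fst z)" if "z \<in> Sigma G (\<lambda>u. A u \<times> B u)" for z
        by (rule SigmaE[OF that]) (simp only: fst_conv snd_conv)
      have pq: "fst p \<in> G" "fst q \<in> G" "fst (snd p) \<in> A (fst p)" "fst (snd q) \<in> A (fst q)"
        using SigmaD[OF p] SigmaD[OF q] by (simp_all only: mem_Times_iff)
      have "fst p = fst q"
      proof (rule PiE_ext)
        show "fst p \<in> {..<t} \<rightarrow>\<^sub>E {..<m}" "fst q \<in> {..<t} \<rightarrow>\<^sub>E {..<m}" using pq(1,2) unfolding G_def by blast+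
        show "fst p l = fst q l" if "l \<in> {..<t}" for l
        proof -
          have "fst (snd p) (r l) = fst p l" "fst (snd q) (r l) = fst q l"
            using pq(3,4) that unfolding A_def by blast+
          then show ?thesis using eq by simp
        qed
      qed
      then show "p = q" using eq by (rule prod_eqI)
    qed
    show "snd ` Sigma G (\<lambda>u. A u \<times> B u) \<subseteq> ?W" by (auto simp: A_def B_def P_def)
    show "finite ?W" by (rule finite_subset[of _ P]) (auto simp: P_def finite_permutations)
  qed
  finally have 1: "(m - 2 * t) ^ t * (fact (m - t) * fact (m - t)) \<le> card ?W" .
  \<comment> \<open>The falling factorial with \<open>t\<close> factors is at most
    \<open>m ^ t\<close>; used for both permutations, it produces the factor
    \<open>m ^ (2 * t)\<close>.\<close>
  have "fact m = fact m div fact (m - t) * (fact (m - t) :: nat)"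
    by (simp add: fact_dvd)
  also have "\<dots> \<le> m ^ t * fact (m - t)"
    using fact_div_fact_le_pow[OF tm] by simp
  finally have "(fact m :: nat) * fact m \<le> (m ^ t * fact (m - t)) * (m ^ t * fact (m - t))"
    by (intro mult_le_mono)
  moreover have "card P = fact m * fact m"
    by (simp add: P_def card_cartesian_product card_permutations)
  ultimately have "(m - 2 * t) ^ t * card P \<le> (m - 2 * t) ^ t * ((m ^ t * fact (m - t)) * (m ^ t * fact (m - t)))"
    by simp
  also have "\<dots> = m ^ (2 * t) * ((m - 2 * t) ^ t * (fact (m - t) * fact (m - t)))"
    unfolding mult_2 power_add by (simp only: mult_ac)
  also have "\<dots> \<le> m ^ (2 * t) * card ?W"
    using 1 by simp
  finally show ?thesis .
qed

subsection \<open>The averaging argument\<close>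

text \<open>Reaches the order \<open>N + r\<close> without losing any of the counted transversals:
  each is extended by the same corner transversal \<open>Y\<close> and can be recovered from its old
  part.\<close>

lemma card_diagonals_le_T:
  fixes R :: "'a set" and C :: "'b set" and S :: "'c set"
  assumes fin: "finite R" "finite C" "finite S" and card: "card R = N" "card C = N" "card S = N"
    and L: "latin R C S L" and K: "latin {..<r} {..<r} {..<r} K"
    and Y: "Y \<subseteq> K" "diagonal {..<r} {..<r} {..<r} Y"
    and \<tau>: "\<And>d. d < r \<Longrightarrow> \<tau> d \<subseteq> L \<and> diagonal R C S (\<tau> d)"
    and disj: "\<And>d d'. d < r \<Longrightarrow> d' < r \<Longrightarrow> d \<noteq> d' \<Longrightarrow> \<tau> d \<inter> \<tau> d' = {}"
    and XX: "\<And>X. X \<in> \<X> \<Longrightarrow> X \<subseteq> L \<and> diagonal R C S X"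
    and disjX: "\<And>X d. X \<in> \<X> \<Longrightarrow> d < r \<Longrightarrow> \<tau> d \<inter> X = {}"
  shows "card \<X> \<le> T (N + r)"
proof -
  define \<Psi> where "\<Psi> X = (\<lambda>(r, c, s). (Inl r, Inl c, Inl s)) ` X \<union> (\<lambda>(x, y, z). (Inr x, Inr y, Inr z)) ` Y"
    for X :: "('a \<times> 'b \<times> 'c) set"
  have mem: "p \<in> X \<longleftrightarrow> (Inl (fst p), Inl (fst (snd p)), Inl (snd (snd p))) \<in> \<Psi> X" for p X
    unfolding \<Psi>_def by (cases p) force
  then have "inj \<Psi>" by (intro injI set_eqI) simp
  then have "card \<X> = card (\<Psi> ` \<X>)" by (metis card_image inj_on_subset subset_UNIV)
  also have "\<dots> \<le> T (N + r)"
  proof (rule T_ge)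
    show "finite (R <+> {..<r})" "finite (C <+> {..<r})" "finite (S <+> {..<r})" using fin by simp_all
    show "card (R <+> {..<r}) = N + r" "card (C <+> {..<r}) = N + r" "card (S <+> {..<r}) = N + r"
      using fin card by (simp_all add: card_Plus)
    show "latin (R <+> {..<r}) (C <+> {..<r}) (S <+> {..<r}) (prolong L {..<r} \<tau> K)"
      by (rule latin_prolong[OF L K]) (use \<tau> disj in auto)
    fix Z assume "Z \<in> \<Psi> ` \<X>"
    then obtain X where X: "X \<in> \<X>" "Z = \<Psi> X" by blast
    have "diagonal R C S X" "X \<subseteq> L" using XX[OF X(1)] by auto
    note * = diagonal_prolong[OF this _ Y(2) Y(1), where \<tau> = \<tau>]
    show "Z \<subseteq> prolong L {..<r} \<tau> K \<and> diagonal (R <+> {..<r}) (C <+> {..<r}) (S <+> {..<r}) Z"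
      unfolding X(2) \<Psi>_def using *[OF disjX[OF X(1)]] by simp
  qed
  finally show ?thesis .
qed

lemma diagonal_bij_image:
  assumes f: "bij_betw f Z R" and g: "bij_betw g Z C" and h: "bij_betw h Z S"
  shows "diagonal R C S ((\<lambda>z. (f z, g z, h z)) ` Z)"
proof -
  note f = bij_betw_facts[OF f] and g = bij_betw_facts[OF g] and h = bij_betw_facts[OF h]
  show ?thesis
    unfolding diagonal_def
  proof (intro allI impI ballI conjI, goal_cases)
    case 1 show ?case using f(1) g(1) h(1) by auto
  next
    case (2 r) then show ?case using f(2)[of r] by blast
  next
    case (3 c) then show ?case using g(2)[of c] by blast
  next
    case (4 s) then show ?case using h(2)[of s] by blast
  qed (auto dest: f(3) g(3) h(3))
qed

text \<open>Every line of the square has \<open>k\<close> entries, exactly one of them on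
  \<open>X\<close>.\<close>

lemma card_lines:
  assumes L: "latin {..<k} {..<k} {..<k} L" and X: "X \<subseteq> L" "diagonal {..<k} {..<k} {..<k} X"
    and i: "i < k"
  shows "card {\<beta> \<in> L - X. fst \<beta> = i} = k - 1"
    and "card {\<beta> \<in> L - X. fst (snd \<beta>) = i} = k - 1"
    and "card {\<beta> \<in> L - X. snd (snd \<beta>) = i} = k - 1"
proof -
  note L = latinD[OF L] and D = diagonalD[OF X(2)]
  have gen: "card {\<beta> \<in> L - X. Q \<beta>} = k - 1"
    if f: "bij_betw f {\<beta> \<in> L. Q \<beta>} {..<k}" and x: "{\<beta> \<in> X. Q \<beta>} = {x}" for Q and f :: "_ \<Rightarrow> nat" and x
  proof -
    have "card {\<beta> \<in> L. Q \<beta>} = k" using bij_betw_same_card[OF f] by simp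
    moreover have "{\<beta> \<in> L - X. Q \<beta>} = {\<beta> \<in> L. Q \<beta>} - {x}" "x \<in> {\<beta> \<in> L. Q \<beta>}"
      using x X(1) by blast+
    ultimately show ?thesis by simp
  qed
  have i': "i \<in> {..<k}" using i by simp
  show "card {\<beta> \<in> L - X. fst \<beta> = i} = k - 1"
  proof -
    obtain c s where x: "(i, c, s) \<in> X" using D(2)[OF i'] by blast
    show ?thesis
    proof (rule gen)
      show "bij_betw (\<lambda>\<beta>. fst (snd \<beta>)) {\<beta> \<in> L. fst \<beta> = i} {..<k}"
        unfolding bij_betw_def inj_on_def using L(1,5) L(2)[OF i'] by (force simp: image_iff)
      show "{\<beta> \<in> X. fst \<beta> = i} = {(i, c, s)}" using x D(5) by fastforce
    qed
  qed
  show "card {\<beta> \<in> L - X. fst (snd \<beta>) = i} = k - 1"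
  proof -
    obtain r s where x: "(r, i, s) \<in> X" using D(3)[OF i'] by blast
    show ?thesis
    proof (rule gen)
      show "bij_betw (\<lambda>\<beta>. fst \<beta>) {\<beta> \<in> L. fst (snd \<beta>) = i} {..<k}"
        unfolding bij_betw_def inj_on_def using L(1,5) L(2)[OF _ i'] by (force simp: image_iff)
      show "{\<beta> \<in> X. fst (snd \<beta>) = i} = {(r, i, s)}" using x D(6) by fastforce
    qed
  qed
  show "card {\<beta> \<in> L - X. snd (snd \<beta>) = i} = k - 1"
  proof -
    obtain r c where x: "(r, c, i) \<in> X" using D(4)[OF i'] by blast
    show ?thesis
    proof (rule gen)
      show "bij_betw (\<lambda>\<beta>. fst \<beta>) {\<beta> \<in> L. snd (snd \<beta>) = i} {..<k}"
        unfolding bij_betw_def inj_on_def using L(1,6) L(3)[OF _ i'] by (force simp: image_iff)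
      show "{\<beta> \<in> X. snd (snd \<beta>) = i} = {(r, c, i)}" using x D(7) by fastforce
    qed
  qed
qed

section \<open>Candidate transversals described by slots\<close>

text \<open>
  A slot \<open>(\<beta>, l)\<close> stands for the \<open>l\<close>-th chosen entry of block \<open>\<beta>\<close>. The map \<open>e\<close> numbers the slots on
  each line (row, column or symbol \<open>i\<close> of the coarse square, read off by \<open>p\<close>) by \<open>{..<m}\<close>, and the
  permutation \<open>\<pi> i\<close> assigns fine coordinates to these numbers.
\<close>

definition slot_coord :: "('b \<Rightarrow> 'i) \<Rightarrow> ('b \<times> nat \<Rightarrow> nat) \<Rightarrow> ('i \<Rightarrow> nat \<Rightarrow> nat) \<Rightarrow> 'b \<times> nat \<Rightarrow> 'i \<times> nat" where
  "slot_coord p e \<pi> z = (p (fst z), \<pi> (p (fst z)) (e z))"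

text \<open>A slot lies on only one line for a given \<open>p\<close>, so the numberings of the
  separate lines glue to a single function.\<close>

lemma slot_enumeration:
  assumes "finite B" and "\<And>i. i \<in> I \<Longrightarrow> card {\<beta> \<in> B. p \<beta> = i} * t = m"
  shows "\<exists>e :: 'b \<times> nat \<Rightarrow> nat. \<forall>i\<in>I. bij_betw e ({\<beta> \<in> B. p \<beta> = i} \<times> {..<t}) {..<m}"
proof -
  have "\<exists>f. bij_betw f ({\<beta> \<in> B. p \<beta> = i} \<times> {..<t}) {..<m}" if "i \<in> I" for i
    using assms that by (intro finite_same_card_bij) (auto simp: card_cartesian_product)
  then obtain f where f: "\<And>i. i \<in> I \<Longrightarrow> bij_betw (f i) ({\<beta> \<in> B. p \<beta> = i} \<times> {..<t}) {..<m}"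
    by metis
  have "bij_betw (\<lambda>z. f (p (fst z)) z) ({\<beta> \<in> B. p \<beta> = i} \<times> {..<t}) {..<m}" if "i \<in> I" for i
    using f[OF that] by (rule bij_betw_cong[THEN iffD1, rotated]) auto
  then show ?thesis by blast
qed

text \<open>Hence any choice of permutations makes the slots meet every fine row (or column, or
  symbol) exactly once.\<close>

lemma bij_slot_coord:
  assumes p: "p ` B \<subseteq> I" and e: "\<And>i. i \<in> I \<Longrightarrow> bij_betw e ({\<beta> \<in> B. p \<beta> = i} \<times> {..<t}) {..<m}"
    and \<pi>: "\<And>i. i \<in> I \<Longrightarrow> \<pi> i permutes {..<m}"
  shows "bij_betw (slot_coord p e \<pi>) (B \<times> {..<t}) (I \<times> {..<m})"
  unfolding bij_betw_def
proof
  have e_lt: "e (\<beta>, l) < m" if "\<beta> \<in> B" "l < t" for \<beta> l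
    using bij_betw_facts(1)[OF e[of "p \<beta>"], of "(\<beta>, l)"] that p by auto
  show "inj_on (slot_coord p e \<pi>) (B \<times> {..<t})"
  proof (rule inj_onI)
    fix y z assume y: "y \<in> B \<times> {..<t}" and z: "z \<in> B \<times> {..<t}"
      and "slot_coord p e \<pi> y = slot_coord p e \<pi> z"
    then have eq: "p (fst y) = p (fst z)" "\<pi> (p (fst z)) (e y) = \<pi> (p (fst z)) (e z)"
      by (auto simp: slot_coord_def)
    have I: "p (fst z) \<in> I" using p z by auto
    from eq(2) have "e y = e z" using permutes_inj[OF \<pi>[OF I]] by (rule injD[rotated])
    then show "y = z"
      by (rule bij_betw_facts(3)[OF e[OF I]]) (use y z eq(1) in auto)
  qed
  show "slot_coord p e \<pi> ` (B \<times> {..<t}) = I \<times> {..<m}"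
  proof
    show "slot_coord p e \<pi> ` (B \<times> {..<t}) \<subseteq> I \<times> {..<m}"
    proof (rule image_subsetI)
      fix z assume z: "z \<in> B \<times> {..<t}"
      then have "p (fst z) \<in> I" "e z < m" using p e_lt[of "fst z" "snd z"] by auto
      then show "slot_coord p e \<pi> z \<in> I \<times> {..<m}"
        using permutes_in_image[OF \<pi>, of "p (fst z)" "e z"] by (simp add: slot_coord_def)
    qed
    show "I \<times> {..<m} \<subseteq> slot_coord p e \<pi> ` (B \<times> {..<t})"
    proof clarify
      fix i a assume i: "i \<in> I" and a: "a < m"
      obtain b where b: "\<pi> i b = a" using permutes_surj[OF \<pi>[OF i]] by (metis surjD)
      then have "b < m" using a permutes_in_image[OF \<pi>[OF i], of b] by simp
      then obtain z where z: "z \<in> {\<beta> \<in> B. p \<beta> = i} \<times> {..<t}" "e z = b"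
        using bij_betw_facts(2)[OF e[OF i], of b] by auto
      then have "slot_coord p e \<pi> z = (i, a)" "z \<in> B \<times> {..<t}" using b by (auto simp: slot_coord_def)
      then show "(i, a) \<in> slot_coord p e \<pi> ` (B \<times> {..<t})" by force
    qed
  qed
qed

text \<open>The slots of a line carry all numbers below \<open>m\<close>, so they reveal all of
  \<open>\<pi> i\<close> there; elsewhere a permutation of \<open>{..<m}\<close> is the
  identity.\<close>

lemma slot_coord_determines:
  assumes e: "\<And>i. i \<in> I \<Longrightarrow> bij_betw e ({\<beta> \<in> B. p \<beta> = i} \<times> {..<t}) {..<m}"
    and \<pi>: "\<pi> \<in> I \<rightarrow>\<^sub>E {\<sigma>. \<sigma> permutes {..<m}}" "\<rho> \<in> I \<rightarrow>\<^sub>E {\<sigma>. \<sigma> permutes {..<m}}"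
    and eq: "\<And>z. z \<in> B \<times> {..<t} \<Longrightarrow> slot_coord p e \<pi> z = slot_coord p e \<rho> z"
  shows "\<pi> = \<rho>"
proof (rule PiE_ext[OF \<pi>])
  fix i assume i: "i \<in> I"
  show "\<pi> i = \<rho> i"
  proof
    fix a
    show "\<pi> i a = \<rho> i a"
    proof (cases "a < m")
      case True
      then obtain z where z: "z \<in> {\<beta> \<in> B. p \<beta> = i} \<times> {..<t}" "e z = a"
        using bij_betw_facts(2)[OF e[OF i], of a] by auto
      then show ?thesis using eq[of z] by (auto simp: slot_coord_def)
    next
      case False
      have "\<pi> i permutes {..<m}" "\<rho> i permutes {..<m}" using \<pi> i by (auto dest: PiE_mem)
      then show ?thesis using False by (simp add: permutes_not_in)
    qed
  qed
qed

text \<open>There are \<open>fact m ^ (3 * k)\<close> ordered candidates, and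
  \<open>k * (k - 1)\<close> independent blocks must each contain \<open>t\<close> prescribed
  entries, \<open>k * m\<close> entries in all. Averaging fixes the blocks; dividing out the order
  of the \<open>t\<close> entries inside each block costs
  \<open>fact t ^ (k * (k - 1))\<close>.\<close>

proposition transversal_count:
  fixes k t m r n :: nat
  assumes M: "latin {..<k} {..<k} {..<k} M" and \<tau>: "\<tau> \<subseteq> M" "diagonal {..<k} {..<k} {..<k} \<tau>"
    and K: "latin {..<r} {..<r} {..<r} K" and Y: "Y \<subseteq> K" "diagonal {..<r} {..<r} {..<r} Y"
    and m: "m = (k - 1) * t" "odd m" "r \<le> m"
  shows "(m - 2 * t) ^ (k * m) * fact m ^ (3 * k)
    \<le> T (k * m + r) * fact t ^ (k * (k - 1)) * m ^ (2 * (k * m))"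
proof -
  define B where "B = M - \<tau>"
  have t: "t > 0" "m > 0" using m by (auto intro!: gr0I)
  have MB: "M \<subseteq> {..<k} \<times> {..<k} \<times> {..<k}" using M by (simp add: latin_def)
  then have finB: "finite B" unfolding B_def by (meson Diff_subset finite_SigmaI finite_lessThan finite_subset)
  define p1 p2 p3 :: "nat \<times> nat \<times> nat \<Rightarrow> nat"
    where "p1 = fst" and "p2 = (\<lambda>\<beta>. fst (snd \<beta>))" and "p3 = (\<lambda>\<beta>. snd (snd \<beta>))"
  have p: "p1 ` B \<subseteq> {..<k}" "p2 ` B \<subseteq> {..<k}" "p3 ` B \<subseteq> {..<k}"
    using MB by (auto simp: B_def p1_def p2_def p3_def)
  have lines: "card {\<beta> \<in> B. p1 \<beta> = i} * t = m" "card {\<beta> \<in> B. p2 \<beta> = i} * t = m" "card {\<beta> \<in> B. p3 \<beta> = i} * t = m"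
    if "i \<in> {..<k}" for i
    using card_lines[OF M \<tau>, of i] that m(1) by (simp_all add: B_def p1_def p2_def p3_def)
  obtain e1 where e1: "\<And>i. i \<in> {..<k} \<Longrightarrow> bij_betw e1 ({\<beta> \<in> B. p1 \<beta> = i} \<times> {..<t}) {..<m}"
    using slot_enumeration[OF finB lines(1)] by blast
  obtain e2 where e2: "\<And>i. i \<in> {..<k} \<Longrightarrow> bij_betw e2 ({\<beta> \<in> B. p2 \<beta> = i} \<times> {..<t}) {..<m}"
    using slot_enumeration[OF finB lines(2)] by blast
  obtain e3 where e3: "\<And>i. i \<in> {..<k} \<Longrightarrow> bij_betw e3 ({\<beta> \<in> B. p3 \<beta> = i} \<times> {..<t}) {..<m}"
    using slot_enumeration[OF finB lines(3)] by blast
  define \<A> where "\<A> = ({..<k} \<rightarrow>\<^sub>E {\<sigma>. \<sigma> permutes {..<m}})"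
  have \<A>: "\<pi> i permutes {..<m}" if "\<pi> \<in> \<A>" "i \<in> {..<k}" for \<pi> i
    using that by (auto simp: \<A>_def dest: PiE_mem)
  \<comment> \<open>An element is an ordered candidate: one permutation of fine coordinates for each
    coarse row, column and symbol.\<close>
  define X where "X = \<A> \<times> \<A> \<times> \<A>"
  have finA: "finite \<A>" unfolding \<A>_def by (intro finite_PiE) (auto simp: finite_permutations)
  have "card \<A> = fact m ^ k"
    unfolding \<A>_def by (subst card_PiE) (simp_all add: card_permutations)
  then have cardX: "card X = fact m ^ (3 * k)"
    by (simp add: X_def card_cartesian_product power_mult power3_eq_cube mult.commute[of 3] mult.assoc)
  have finX: "finite X" using finA by (simp add: X_def)
  define Z where "Z = B \<times> {..<t}"
  define cell where "cell x z = (slot_coord p1 e1 (fst x) z, slot_coord p2 e2 (fst (snd x)) z, slot_coord p3 e3 (snd (snd x)) z)" for x z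
  have bij: "bij_betw (slot_coord p1 e1 (fst x)) Z ({..<k} \<times> {..<m})"
    "bij_betw (slot_coord p2 e2 (fst (snd x))) Z ({..<k} \<times> {..<m})"
    "bij_betw (slot_coord p3 e3 (snd (snd x))) Z ({..<k} \<times> {..<m})" if "x \<in> X" for x
    using that unfolding Z_def X_def
    by (intro bij_slot_coord p e1 e2 e3 \<A>; auto)+
  \<comment> \<open>The slots biject with the fine rows, which counts the blocks; some candidate is
    needed to supply the bijection.\<close>
  have card_B: "card B = k * (k - 1)"
  proof -
    obtain \<pi> where "\<pi> \<in> \<A>" using \<open>card \<A> = fact m ^ k\<close> by (metis card.empty ex_in_conv fact_nonzero power_not_zero)
    then have "(\<pi>, \<pi>, \<pi>) \<in> X" by (simp add: X_def)
    from bij_betw_same_card[OF bij(1)[OF this]] have "card B * t = k * ((k - 1) * t)"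
      by (simp add: Z_def card_cartesian_product m(1))
    then show ?thesis using t(1) by simp
  qed
  have km: "t * card B = k * m" by (simp add: card_B m(1))
  define P where "P = {\<alpha>. \<alpha> permutes {..<m}} \<times> {\<gamma>. \<gamma> permutes {..<m}}"
  have P_perm: "fst w permutes {..<m}" "snd w permutes {..<m}" if "w \<in> P" for w
    using that by (auto simp: P_def)
  define \<Omega> where "\<Omega> = (B \<rightarrow>\<^sub>E P)"
  have fin\<Omega>: "finite \<Omega>"
    unfolding \<Omega>_def by (intro finite_PiE finB) (auto simp: P_def finite_permutations)
  have ne: "\<Omega> \<noteq> {}"
    unfolding \<Omega>_def by (auto simp: PiE_eq_empty_iff P_def intro: permutes_id)
  \<comment> \<open>The event that block \<open>\<beta>\<close>, built from \<open>w\<close>,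
    contains all \<open>t\<close> entries that \<open>x\<close> prescribes there.\<close>
  define g where "g x \<beta> w \<longleftrightarrow> (\<forall>l<t. snd w ((fst w (snd (fst (cell x (\<beta>, l)))) + snd (fst (snd (cell x (\<beta>, l))))) mod m)
      = snd (snd (snd (cell x (\<beta>, l)))))" for x \<beta> w
  have many: "((m - 2 * t) ^ t) ^ card B * card \<Omega> \<le> (m ^ (2 * t)) ^ card B * card {\<omega> \<in> \<Omega>. \<forall>\<beta>\<in>B. g x \<beta> (\<omega> \<beta>)}"
    if x: "x \<in> X" for x
    unfolding \<Omega>_def
  proof (rule card_PiE_filter[OF finB])
    fix \<beta> assume \<beta>: "\<beta> \<in> B"
    \<comment> \<open>Slots of one block share their coarse coordinate, so distinct slots must
      differ in the fine one.\<close>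
    have line: "inj_on (\<lambda>l. snd (slot_coord p e \<pi> (\<beta>, l))) {..<t}" "(\<lambda>l. snd (slot_coord p e \<pi> (\<beta>, l))) ` {..<t} \<subseteq> {..<m}"
      if "bij_betw (slot_coord p e \<pi>) Z ({..<k} \<times> {..<m})" for p :: "nat \<times> nat \<times> nat \<Rightarrow> nat" and e \<pi>
    proof -
      show "inj_on (\<lambda>l. snd (slot_coord p e \<pi> (\<beta>, l))) {..<t}"
      proof (rule inj_onI)
        fix l l' assume l: "l \<in> {..<t}" "l' \<in> {..<t}"
          and "snd (slot_coord p e \<pi> (\<beta>, l)) = snd (slot_coord p e \<pi> (\<beta>, l'))"
        then have "slot_coord p e \<pi> (\<beta>, l) = slot_coord p e \<pi> (\<beta>, l')" by (simp add: slot_coord_def)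
        from bij_betw_facts(3)[OF that this] show "l = l'" using l \<beta> by (simp add: Z_def)
      qed
      show "(\<lambda>l. snd (slot_coord p e \<pi> (\<beta>, l))) ` {..<t} \<subseteq> {..<m}"
      proof (rule image_subsetI)
        fix l assume "l \<in> {..<t}"
        then have "slot_coord p e \<pi> (\<beta>, l) \<in> {..<k} \<times> {..<m}"
          using bij_betw_facts(1)[OF that] \<beta> by (simp add: Z_def)
        then show "snd (slot_coord p e \<pi> (\<beta>, l)) \<in> {..<m}" by (rule mem_Times_iff[THEN iffD1, THEN conjunct2])
      qed
    qed
    show "(m - 2 * t) ^ t * card P \<le> m ^ (2 * t) * card {w \<in> P. g x \<beta> w}"
      using card_block_extending[OF line[OF bij(1)[OF x]] line(2)[OF bij(2)[OF x]] line[OF bij(3)[OF x]]]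
      unfolding P_def g_def cell_def fst_conv snd_conv .
  qed
  obtain \<omega> where \<omega>: "\<omega> \<in> \<Omega>" and avg: "((m - 2 * t) ^ t) ^ card B * card X
      \<le> (m ^ (2 * t)) ^ card B * card {x \<in> X. \<forall>\<beta>\<in>B. g x \<beta> (\<omega> \<beta>)}"
    using exists_average[OF fin\<Omega> finX ne, where good = "\<lambda>\<omega> x. \<forall>\<beta>\<in>B. g x \<beta> (\<omega> \<beta>)", OF many] by blast
  define X' where "X' = {x \<in> X. \<forall>\<beta>\<in>B. g x \<beta> (\<omega> \<beta>)}"
  define cells where "cells x = cell x ` Z" for x
  have diag: "diagonal ({..<k} \<times> {..<m}) ({..<k} \<times> {..<m}) ({..<k} \<times> {..<m}) (cells x)" if "x \<in> X" for x
    unfolding cells_def cell_def by (rule diagonal_bij_image[OF bij[OF that]])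
  \<comment> \<open>The coarse coordinates of an entry name its block, so a set of entries splits
    into blocks without reference to the slots.\<close>
  have cell_tag: "(fst (fst (cell x z)), fst (fst (snd (cell x z))), fst (snd (snd (cell x z)))) = fst z" for x z
    by (simp add: cell_def slot_coord_def p1_def p2_def p3_def)
  have cell_inj: "inj_on (cell x) Z" if "x \<in> X" for x
    using bij_betw_imp_inj_on[OF bij(1)[OF that]] by (auto simp: inj_on_def cell_def)
  have cell_determines: "x = y" if x: "x \<in> X" and y: "y \<in> X" and eq: "\<And>z. z \<in> Z \<Longrightarrow> cell x z = cell y z" for x y
  proof (intro prod_eqI)
    have x': "fst x \<in> \<A>" "fst (snd x) \<in> \<A>" "snd (snd x) \<in> \<A>"
      and y': "fst y \<in> \<A>" "fst (snd y) \<in> \<A>" "snd (snd y) \<in> \<A>"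
      using x y by (auto simp: X_def)
    have eq': "slot_coord p1 e1 (fst x) z = slot_coord p1 e1 (fst y) z"
      "slot_coord p2 e2 (fst (snd x)) z = slot_coord p2 e2 (fst (snd y)) z"
      "slot_coord p3 e3 (snd (snd x)) z = slot_coord p3 e3 (snd (snd y)) z" if "z \<in> B \<times> {..<t}" for z
      using eq[of z] that unfolding Z_def cell_def by simp_all
    show "fst x = fst y"
      using e1 x'(1) y'(1) eq'(1) unfolding \<A>_def by (rule slot_coord_determines)
    show "fst (snd x) = fst (snd y)"
      using e2 x'(2) y'(2) eq'(2) unfolding \<A>_def by (rule slot_coord_determines)
    show "snd (snd x) = snd (snd y)"
      using e3 x'(3) y'(3) eq'(3) unfolding \<A>_def by (rule slot_coord_determines)
  qed
  \<comment> \<open>An ordered candidate with underlying set \<open>U\<close> amounts to an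
    enumeration, for each block, of the \<open>t\<close> entries of \<open>U\<close> in that block.
    Each block has \<open>fact t\<close> enumerations.\<close>
  have fibre: "card {y \<in> X'. cells y = U} \<le> fact t ^ card B" if U: "U \<in> cells ` X'" for U
  proof -
    obtain x where x: "x \<in> X" "U = cells x" using U by (auto simp: X'_def)
    define U' where "U' \<beta> = {y \<in> U. (fst (fst y), fst (fst (snd y)), fst (snd (snd y))) = \<beta>}" for \<beta>
    have "U' \<beta> = cell x ` ({\<beta>} \<times> {..<t})" if "\<beta> \<in> B" for \<beta>
      using that cell_tag[of x] by (auto simp: U'_def x(2) cells_def Z_def)
    moreover have "inj_on (cell x) ({\<beta>} \<times> {..<t})" if "\<beta> \<in> B" for \<beta>
      using cell_inj[OF x(1)] by (rule inj_on_subset) (use that in \<open>auto simp: Z_def\<close>)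
    ultimately have U': "finite (U' \<beta>)" "card (U' \<beta>) = t" if "\<beta> \<in> B" for \<beta>
      using that by (simp_all add: card_image)
    define \<Phi> where "\<Phi> y = (\<lambda>\<beta>\<in>B. \<lambda>l\<in>{..<t}. cell y (\<beta>, l))" for y
    have "card {y \<in> X'. cells y = U} \<le> card (PiE B (\<lambda>\<beta>. {f \<in> {..<t} \<rightarrow>\<^sub>E U' \<beta>. inj_on f {..<t}}))"
    proof (rule card_inj_on_le[where f = \<Phi>])
      show "inj_on \<Phi> {y \<in> X'. cells y = U}"
      proof (rule inj_onI)
        fix y y' assume y: "y \<in> {y \<in> X'. cells y = U}" "y' \<in> {y \<in> X'. cells y = U}" and eq: "\<Phi> y = \<Phi> y'"
        have "cell y z = cell y' z" if "z \<in> Z" for z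
          using fun_cong[OF fun_cong[OF eq, of "fst z"], of "snd z"] that by (auto simp: \<Phi>_def Z_def)
        then show "y = y'" by (rule cell_determines[rotated 2]) (use y in \<open>auto simp: X'_def\<close>)
      qed
      show "\<Phi> ` {y \<in> X'. cells y = U} \<subseteq> PiE B (\<lambda>\<beta>. {f \<in> {..<t} \<rightarrow>\<^sub>E U' \<beta>. inj_on f {..<t}})"
      proof (rule image_subsetI)
        fix y assume "y \<in> {y \<in> X'. cells y = U}"
        then have y: "y \<in> X" "cells y = U" by (auto simp: X'_def)
        have "(\<lambda>l\<in>{..<t}. cell y (\<beta>, l)) \<in> {..<t} \<rightarrow>\<^sub>E U' \<beta>" if "\<beta> \<in> B" for \<beta>
          using that cell_tag[of y] by (auto simp: U'_def y(2)[symmetric] cells_def Z_def)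
        moreover have "inj_on (\<lambda>l\<in>{..<t}. cell y (\<beta>, l)) {..<t}" if "\<beta> \<in> B" for \<beta>
          using that by (auto simp: inj_on_def Z_def dest: inj_onD[OF cell_inj[OF y(1)]])
        ultimately show "\<Phi> y \<in> PiE B (\<lambda>\<beta>. {f \<in> {..<t} \<rightarrow>\<^sub>E U' \<beta>. inj_on f {..<t}})"
          unfolding \<Phi>_def by (intro restrict_PiE_iff[THEN iffD2]) blast
      qed
      show "finite (PiE B (\<lambda>\<beta>. {f \<in> {..<t} \<rightarrow>\<^sub>E U' \<beta>. inj_on f {..<t}}))"
      proof (rule finite_PiE[OF finB])
        show "finite {f \<in> {..<t} \<rightarrow>\<^sub>E U' \<beta>. inj_on f {..<t}}" if "\<beta> \<in> B" for \<beta>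
          by (rule finite_subset[of _ "{..<t} \<rightarrow>\<^sub>E U' \<beta>"]) (use U'(1)[OF that] in \<open>auto intro: finite_PiE\<close>)
      qed
    qed
    also have "\<dots> = (\<Prod>\<beta>\<in>B. fact t)"
      unfolding card_PiE[OF finB] by (rule prod.cong) (simp_all add: card_injective_funcset U')
    finally show ?thesis by simp
  qed
  have "card (cells ` X') \<le> T (k * m + r)"
  proof -
    \<comment> \<open>Blocks on \<open>\<tau>\<close> stay cyclic so that their cyclic diagonals are
      available for the prolongation; the others are those fixed by averaging.\<close>
    define W where "W \<beta> = (if \<beta> \<in> \<tau> then block m (id, id) else block m (\<omega> \<beta>))" for \<beta>
    define \<delta> where "\<delta> d = inflate \<tau> (\<lambda>_. cyclic_diagonal m d)" for d
    let ?D = "{..<k} \<times> {..<m}"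
    have fin: "finite ?D" and card: "card ?D = k * m" by simp_all
    have L: "latin ?D ?D ?D (inflate M W)"
    proof (rule latin_inflate[OF M])
      fix \<beta> assume "\<beta> \<in> M"
      then have "\<beta> \<notin> \<tau> \<Longrightarrow> \<omega> \<beta> \<in> P" using \<omega> by (auto simp: \<Omega>_def B_def dest: PiE_mem)
      then show "latin {..<m} {..<m} {..<m} (W \<beta>)"
        using latin_block[of "(id, id)" m] latin_block[of "\<omega> \<beta>" m] P_perm[of "\<omega> \<beta>"]
        by (cases "\<beta> \<in> \<tau>") (simp_all add: W_def permutes_id)
    qed
    have "\<delta> d \<subseteq> inflate M W" for d
      unfolding \<delta>_def
      by (rule inflate_mono[OF \<tau>(1)]) (simp add: W_def cyclic_diagonal_subset)
    moreover have "diagonal ?D ?D ?D (\<delta> d)" for d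
      unfolding \<delta>_def by (rule diagonal_inflate[OF \<tau>(2) diagonal_cyclic_diagonal[OF m(2)]])
    ultimately have \<delta>: "\<delta> d \<subseteq> inflate M W \<and> diagonal ?D ?D ?D (\<delta> d)" for d by blast
    have disj: "\<delta> d \<inter> \<delta> d' = {}" if "d < r" "d' < r" "d \<noteq> d'" for d d'
    proof -
      have "cyclic_diagonal m d \<inter> cyclic_diagonal m d' = {}"
        by (rule cyclic_diagonal_disjoint) (use that m(3) in auto)
      then show ?thesis unfolding \<delta>_def inflate_def by blast
    qed
    \<comment> \<open>Candidates use only blocks off \<open>\<tau>\<close>, whereas
      \<open>\<delta> d\<close> lies entirely in blocks on \<open>\<tau>\<close>.\<close>
    have disjX: "\<delta> d \<inter> U = {}" if "U \<in> cells ` X'" for U d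
    proof -
      have "(fst (fst y), fst (fst (snd y)), fst (snd (snd y))) \<in> B" if "y \<in> U" for y
        using that \<open>U \<in> cells ` X'\<close> by (auto simp: cells_def cell_tag Z_def)
      moreover have "(fst (fst y), fst (fst (snd y)), fst (snd (snd y))) \<in> \<tau>" if "y \<in> \<delta> d" for y
        using that by (auto simp: \<delta>_def inflate_def)
      ultimately show ?thesis unfolding B_def by blast
    qed
    have cells: "cells x \<subseteq> inflate M W \<and> diagonal ?D ?D ?D (cells x)" if x: "x \<in> X'" for x
    proof
      have xX: "x \<in> X" and gx: "\<And>\<beta>. \<beta> \<in> B \<Longrightarrow> g x \<beta> (\<omega> \<beta>)" using x by (auto simp: X'_def)
      then show "diagonal ?D ?D ?D (cells x)" by (intro diag)
      show "cells x \<subseteq> inflate M W"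
        unfolding cells_def
      proof (rule image_subsetI)
        fix z assume z: "z \<in> Z"
        obtain i a j b s c where y: "cell x z = ((i, a), (j, b), (s, c))" by (metis prod.collapse)
        have \<beta>: "(i, j, s) \<in> B" "(i, j, s) = fst z" using cell_tag[of x z] z y by (auto simp: Z_def)
        have "a < m" "b < m" using diagonalD(1)[OF diag[OF xX], of "(i, a)" "(j, b)" "(s, c)"] y z
          by (auto simp: cells_def image_iff) metis+
        moreover have "snd (\<omega> (fst z)) ((fst (\<omega> (fst z)) a + b) mod m) = c"
        proof -
          have "fst z \<in> B" "snd z < t" using z by (auto simp: Z_def)
          from gx[OF this(1), unfolded g_def, rule_format, OF this(2)] show ?thesis
            using y by simp
        qed
        ultimately have "(a, b, c) \<in> W (i, j, s)" using \<beta> by (simp add: W_def B_def block_def)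
        then show "cell x z \<in> inflate M W" using \<beta>(1) y by (simp add: B_def)
      qed
    qed
    show ?thesis
      by (rule card_diagonals_le_T[OF fin fin fin card card card L K Y, where \<tau> = \<delta>])
        (use \<delta> disj disjX cells in blast)+
  qed
  moreover have "card X' \<le> card (cells ` X') * fact t ^ card B"
  proof (rule card_le_fibres)
    show "finite X'" using finX by (simp add: X'_def)
  qed (rule fibre)
  ultimately have "card X' \<le> T (k * m + r) * fact t ^ card B"
    by (meson le_trans mult_le_mono1)
  then have "(m ^ (2 * t)) ^ card B * card X' \<le> (m ^ (2 * t)) ^ card B * (T (k * m + r) * fact t ^ card B)"
    by simp
  with avg have "((m - 2 * t) ^ t) ^ card B * card X \<le> (m ^ (2 * t)) ^ card B * (T (k * m + r) * fact t ^ card B)"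
    unfolding X'_def by (rule le_trans)
  then show ?thesis
    unfolding power_mult[symmetric] km cardX mult.assoc[of 2] by (simp only: card_B mult_ac)
qed

text \<open>With \<open>k\<close> even and \<open>t\<close> odd, \<open>m\<close> is odd; the coarse
  square and the corner come from \<open>latin_with_diagonal\<close>, whence the bound 3 on
  \<open>r\<close>.\<close>

lemma transversal_count_even:
  assumes "even k" "k \<ge> 4" "odd t" "3 \<le> r" "r \<le> (k - 1) * t"
  defines "m \<equiv> (k - 1) * t"
  shows "(m - 2 * t) ^ (k * m) * fact m ^ (3 * k)
    \<le> T (k * m + r) * fact t ^ (k * (k - 1)) * m ^ (2 * (k * m))"
proof -
  obtain M \<tau> :: "(nat \<times> nat \<times> nat) set" where M: "latin {..<k} {..<k} {..<k} M" "\<tau> \<subseteq> M" "diagonal {..<k} {..<k} {..<k} \<tau>"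
    using latin_with_diagonal[of k] assms(2) by auto
  obtain K Y :: "(nat \<times> nat \<times> nat) set" where K: "latin {..<r} {..<r} {..<r} K" "Y \<subseteq> K" "diagonal {..<r} {..<r} {..<r} Y"
    using latin_with_diagonal[of r] assms(4) by auto
  have "odd m" using assms by (simp add: m_def)
  then show ?thesis
    by (intro transversal_count[OF M K]) (use assms in \<open>auto simp: m_def\<close>)
qed

subsection \<open>Asymptotics\<close>

text \<open>\<open>n ^ n / fact n\<close> is a single term of the exponential series at
  \<open>n\<close>.\<close>

lemma fact_ge_power_div_exp: "(real n / exp 1) ^ n \<le> fact n"
proof -
  have "summable (\<lambda>i. real n ^ i /\<^sub>R fact i)" by (rule summable_exp_generic)
  then have "real n ^ n /\<^sub>R fact n \<le> (\<Sum>i. real n ^ i /\<^sub>R fact i)"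
    using sum_le_suminf[of "\<lambda>i. real n ^ i /\<^sub>R fact i" "{n}"] by simp
  then have "real n ^ n / fact n \<le> exp (real n)"
    by (simp add: exp_def divide_inverse mult.commute)
  then show ?thesis
    by (simp add: power_divide field_simps flip: exp_of_nat_mult)
qed

text \<open>Equality holds at 1, and the induction step amounts to e \<le> (1 + 1/n)^(n +
  1).\<close>

lemma fact_le_power_div_exp:
  assumes "n \<ge> 1"
  shows "fact n \<le> exp 1 * real n * (real n / exp 1) ^ n"
  using assms
proof (induction n rule: dec_induct)
  case (step n)
  have n: "real n > 0" using step by simp
  \<comment> \<open>This is ln x \<le> x - 1 at x = n / (n + 1), negated.\<close>
  have "1 / (real n + 1) \<le> ln (1 + 1 / real n)"
  proof -
    have "ln (real n / (real n + 1)) \<le> real n / (real n + 1) - 1"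
      using n by (intro ln_le_minus_one) simp
    then show ?thesis using n by (simp add: ln_div field_simps)
  qed
  then have "1 \<le> real (Suc n) * ln (1 + 1 / real n)" using n by (simp add: field_simps)
  then have "exp 1 \<le> exp (real (Suc n) * ln (1 + 1 / real n))" by simp
  also have "\<dots> = (1 + 1 / real n) ^ Suc n"
    unfolding exp_of_nat_mult using n by (subst exp_ln) (auto intro: add_pos_pos)
  finally have e: "exp 1 * real n ^ Suc n \<le> real (Suc n) ^ Suc n"
    using n by (simp add: field_simps flip: power_mult_distrib del: power_Suc)
  have "fact (Suc n) = real (Suc n) * fact n" by simp
  also have "\<dots> \<le> real (Suc n) * (exp 1 * real n * (real n / exp 1) ^ n)"
    by (intro mult_left_mono step.IH) simp
  also have "\<dots> = real (Suc n) * exp 1 * (exp 1 * real n ^ Suc n) / exp 1 ^ Suc n"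
    by (simp add: power_divide)
  also have "\<dots> \<le> real (Suc n) * exp 1 * real (Suc n) ^ Suc n / exp 1 ^ Suc n"
    using e by (intro divide_right_mono mult_left_mono) auto
  finally show ?case by (simp add: power_divide mult_ac)
qed simp

section \<open>From the exact count to the asymptotic bound\<close>

text \<open>Inserting the factorial bounds collapses the count to an \<open>N\<close>-th power with
  base \<open>(m - 2 * t) * m / (t * e\<^sup>2)\<close>, which is
  \<open>N * (1 - 3 / k) / e\<^sup>2\<close>. The factor \<open>(exp 1 * real t) ^ c\<close> is the
  error of the upper bound for \<open>fact t\<close>, polynomial in \<open>t\<close> for fixed
  \<open>k\<close>.\<close>

lemma T_ge_power:
  fixes k t r :: nat
  assumes k: "even k" "k \<ge> 4" and t: "odd t" and r: "3 \<le> r" "r \<le> (k - 1) * t"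
  defines "c \<equiv> k * (k - 1)"
  shows "(real (c * t) * (1 - 3 / real k) / (exp 1)\<^sup>2) ^ (c * t) \<le> real (T (c * t + r)) * (exp 1 * real t) ^ c"
proof -
  define m where "m = (k - 1) * t"
  define N where "N = c * t"
  have N: "k * m = N" by (simp add: m_def N_def c_def)
  have t0: "t > 0" using t by (auto intro!: gr0I)
  have m0: "m > 0" using t0 k by (simp add: m_def)
  have k1: "real (k - 1) = real k - 1" using k by simp
  have rm: "real m = (real k - 1) * real t" by (simp only: m_def of_nat_mult k1)
  have mt: "real (m - 2 * t) = (real k - 3) * real t"
  proof -
    have "2 \<le> k - 1" using k by linarith
    then have "2 * t \<le> m" unfolding m_def by (rule mult_le_mono1)
    then show ?thesis using k by (simp add: m_def of_nat_diff algebra_simps)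
  qed
  have main: "real (m - 2 * t) ^ N * fact m ^ (3 * k) \<le> real (T (N + r)) * fact t ^ c * real m ^ (2 * N)"
    using transversal_count_even[OF k t r, folded m_def, unfolded N, folded c_def]
    by (metis (no_types, lifting) of_nat_fact of_nat_le_iff of_nat_mult of_nat_power)
  have "real (m - 2 * t) ^ N * (real m / exp 1) ^ (3 * N) = real (m - 2 * t) ^ N * ((real m / exp 1) ^ m) ^ (3 * k)"
    by (simp add: N[symmetric] mult_ac flip: power_mult)
  also have "\<dots> \<le> real (m - 2 * t) ^ N * fact m ^ (3 * k)"
    by (intro mult_left_mono power_mono fact_ge_power_div_exp) auto
  also have "\<dots> \<le> real (T (N + r)) * fact t ^ c * real m ^ (2 * N)" by (rule main)
  also have "\<dots> \<le> real (T (N + r)) * (exp 1 * real t * (real t / exp 1) ^ t) ^ c * real m ^ (2 * N)"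
    using t0 by (intro mult_left_mono mult_right_mono power_mono fact_le_power_div_exp) auto
  also have "\<dots> = real (T (N + r)) * (exp 1 * real t) ^ c * (real t / exp 1) ^ N * real m ^ (2 * N)"
    by (simp add: N_def power_mult_distrib mult.commute[of c] flip: power_mult)
  finally have "real (m - 2 * t) ^ N * (real m / exp 1) ^ (3 * N) / ((real t / exp 1) ^ N * real m ^ (2 * N))
      \<le> real (T (N + r)) * (exp 1 * real t) ^ c"
    using t0 m0 by (subst pos_divide_le_eq) (auto simp: mult_ac)
  also have "real (m - 2 * t) ^ N * (real m / exp 1) ^ (3 * N) / ((real t / exp 1) ^ N * real m ^ (2 * N))
      = (real (m - 2 * t) * (real m / exp 1) ^ 3 / (real t / exp 1 * real m ^ 2)) ^ N"
    by (simp add: power_mult power_mult_distrib power_divide)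
  also have "real (m - 2 * t) * (real m / exp 1) ^ 3 / (real t / exp 1 * real m ^ 2)
      = real (m - 2 * t) * real m / (real t * (exp 1)\<^sup>2)"
    using t0 m0 by (simp add: power2_eq_square power3_eq_cube field_simps)
  also have "\<dots> = (real k - 3) * ((real k - 1) * real t) / (exp 1)\<^sup>2"
    using t0 unfolding mt rm by simp
  also have "(real k - 3) * ((real k - 1) * real t) = real N * (1 - 3 / real k)"
    using k by (simp add: N_def c_def k1 field_simps)
  finally show ?thesis by (simp add: N_def)
qed

text \<open>With \<open>k\<close> fixed so that \<open>3 / k < \<delta>\<close>, the base exceeds
  the target by the factor \<open>exp \<eta>\<close>. This gain, linear in \<open>n\<close> after
  taking logarithms, absorbs the logarithmic losses from \<open>r\<close> and from
  \<open>(exp 1 * real t) ^ c\<close>.\<close>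

lemma eventually_T_ge:
  fixes \<delta> :: real
  assumes \<delta>: "0 < \<delta>" "\<delta> < 1"
  shows "eventually (\<lambda>n. ((1 - \<delta>) * (real n / (exp 1)\<^sup>2)) ^ n \<le> real (T n)) sequentially"
proof -
  obtain j :: nat where j: "real j > 3 / \<delta>" using reals_Archimedean2 by blast
  define k where "k = 2 * j + 4"
  have k: "even k" "k \<ge> 4" by (auto simp: k_def)
  have k\<delta>: "3 / real k < \<delta>"
  proof -
    have "3 / \<delta> < real k" using j by (simp add: k_def)
    then show ?thesis using \<delta> k by (simp add: field_simps)
  qed
  define c where "c = k * (k - 1)"
  define R where "R = 3 + 2 * c"
  define \<eta> where "\<eta> = ln (1 - 3 / real k) - ln (1 - \<delta>)"
  have \<eta>: "\<eta> > 0" using \<delta> k k\<delta> by (simp add: \<eta>_def)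
  have c: "c > 0" using k by (simp add: c_def)
  have "filterlim (\<lambda>n. (real n - real R) * \<eta> - (real R + real c) * ln (real n) - real R - real c) at_top sequentially"
    using \<eta> by real_asymp
  then have "eventually (\<lambda>n. (real n - real R) * \<eta> - (real R + real c) * ln (real n) - real R - real c \<ge> 0) sequentially"
    unfolding filterlim_at_top by blast
  \<comment> \<open>This threshold forces \<open>R \<le> q\<close> below, so that \<open>r\<close>
    does not exceed the number of available disjoint transversals.\<close>
  moreover have "eventually (\<lambda>n. n \<ge> 3 + c + c * (R * 2)) sequentially" by (rule eventually_ge_at_top)
  ultimately show ?thesis
  proof eventually_elim
    case (elim n)
    \<comment> \<open>Division by \<open>2 * c\<close> keeps \<open>t = 2 * q + 1\<close> odd. Of
      what is subtracted from \<open>n\<close>, \<open>c\<close> belongs to the odd unit of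
      \<open>t\<close> and 3 is returned to \<open>r\<close>, making \<open>r\<close> at least
      3.\<close>
    define q where "q = (n - 3 - c) div (2 * c)"
    define t where "t = 2 * q + 1"
    define r where "r = 3 + (n - 3 - c) mod (2 * c)"
    have n: "n = c * t + r"
    proof -
      have "2 * c * q + (n - 3 - c) mod (2 * c) = n - 3 - c" by (simp add: q_def)
      moreover have "3 + c \<le> n" using elim(2) by simp
      ultimately show ?thesis by (simp add: t_def r_def algebra_simps)
    qed
    have rR: "3 \<le> r" "r \<le> R" using c by (auto simp: r_def R_def intro: less_imp_le)
    have Rt: "R \<le> t"
    proof -
      have "c * (R * 2) \<le> n - 3 - c" using elim(2) by simp
      then have "R \<le> q" using c unfolding q_def by (subst less_eq_div_iff_mult_less_eq) (simp_all add: mult_ac)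
      then show ?thesis by (simp add: t_def)
    qed
    also have "t \<le> (k - 1) * t" using mult_le_mono1[of 1 "k - 1" t] k by linarith
    finally have "r \<le> (k - 1) * t" using rR by linarith
    have "odd t" by (simp add: t_def)
    define N where "N = c * t"
    have N: "N > 0" "N \<le> n" "real n - real R \<le> real N" "real n = real N + real r"
      using c rR by (auto simp: N_def n t_def)
    have n0: "real n > 0" using N by simp
    have "t \<le> c * t" using c by simp
    then have tn: "1 \<le> t" "t \<le> n" using n by (simp_all add: t_def)
    have k3: "0 < 1 - 3 / real k" using k by simp
    have e2: "(exp 1)\<^sup>2 = exp (2 :: real)" by (simp flip: exp_of_nat_mult)
    \<comment> \<open>After multiplication by \<open>N\<close>, replacing \<open>ln N\<close> by
      \<open>ln n\<close> costs at most \<open>r\<close>.\<close>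
    have "ln (real n) - ln (real N) \<le> real r / real N"
    proof -
      have "ln (real n / real N) \<le> real n / real N - 1"
        using N n0 by (intro ln_le_minus_one) simp
      moreover have "ln (real n / real N) = ln (real n) - ln (real N)"
        using N(1) n0 by (intro ln_divide_pos) auto
      moreover have "real n / real N - 1 = real r / real N"
        using N(1) by (simp add: N(4) add_divide_distrib)
      ultimately show ?thesis by linarith
    qed
    then have lnN: "real N * ln (real n) - real r \<le> real N * ln (real N)"
      using N by (simp add: field_simps)
    \<comment> \<open>The claim in logarithmic form. The losses are \<open>R * ln n\<close> for the
      \<open>r\<close> extra factors, \<open>c * (1 + ln n)\<close> for the polynomial error and
      \<open>r\<close> from the previous step; the gain is \<open>N * \<eta>\<close>.\<close>
    have "real n * (ln (1 - \<delta>) + ln (real n) - 2) + real c * (1 + ln (real t))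
        \<le> real N * (ln (real N) + ln (1 - 3 / real k) - 2)"
    proof -
      have "ln (real t) \<le> ln (real n)" using tn by simp
      then have 1: "real c * (1 + ln (real t)) \<le> real c * (1 + ln (real n))" by (intro mult_left_mono) auto
      have "ln (1 - \<delta>) \<le> 0" using \<delta> by simp
      then have "real r * (ln (1 - \<delta>) + ln (real n) - 2) \<le> real r * ln (real n)"
        by (intro mult_left_mono) auto
      also have "\<dots> \<le> real R * ln (real n)"
        using rR N by (intro mult_right_mono) auto
      finally have 2: "real r * (ln (1 - \<delta>) + ln (real n) - 2) \<le> real R * ln (real n)" .
      have 3: "(real n - real R) * \<eta> \<le> real N * \<eta>" using N \<eta> by (intro mult_right_mono) auto
      have "real n * (ln (1 - \<delta>) + ln (real n) - 2) = real N * (ln (1 - \<delta>) + ln (real n) - 2) + real r * (ln (1 - \<delta>) + ln (real n) - 2)"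
        by (simp add: N(4) distrib_right)
      moreover have "real r \<le> real R" using rR by simp
      moreover have "real N * \<eta> = real N * ln (1 - 3 / real k) - real N * ln (1 - \<delta>)"
        by (simp add: \<eta>_def right_diff_distrib)
      ultimately show ?thesis
        using 1 2 3 lnN elim(1) by (simp add: algebra_simps)
    qed
    then have "exp (real n * (ln (1 - \<delta>) + ln (real n) - 2)) * exp (real c * (1 + ln (real t)))
        \<le> exp (real N * (ln (real N) + ln (1 - 3 / real k) - 2))"
      by (simp flip: exp_add)
    also have "exp (real n * (ln (1 - \<delta>) + ln (real n) - 2)) = ((1 - \<delta>) * (real n / (exp 1)\<^sup>2)) ^ n"
      unfolding exp_of_nat_mult e2 using \<delta> n0 by (simp add: exp_add exp_diff)
    also have "exp (real c * (1 + ln (real t))) = (exp 1 * real t) ^ c"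
      using tn unfolding exp_of_nat_mult by (simp add: exp_add)
    also have "exp (real N * (ln (real N) + ln (1 - 3 / real k) - 2)) = (real N * (1 - 3 / real k) / (exp 1)\<^sup>2) ^ N"
      unfolding exp_of_nat_mult e2 using N k3 by (simp add: exp_add exp_diff)
    also have "\<dots> \<le> real (T n) * (exp 1 * real t) ^ c"
      using T_ge_power[OF k \<open>odd t\<close> rR(1) \<open>r \<le> (k - 1) * t\<close>] unfolding N_def n c_def by simp
    finally show ?case using tn by (simp add: mult_le_cancel_right)
  qed
qed

text \<open>The eventual bounds, one for each fixed \<open>\<delta>\<close>, are merged into one
  null sequence by reading the error off \<open>T n\<close> itself.\<close>

theorem theorem1p3:
  "\<exists>\<epsilon> :: nat \<Rightarrow> real. \<epsilon> \<longlonglongrightarrow> 0 \<and>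
     (\<forall>n\<ge>1. real (T n) \<ge> ((1 - \<epsilon> n) * (real n / (exp 1)\<^sup>2)) ^ n)"
proof -
  \<comment> \<open>The least nonnegative error for which the bound holds at
    \<open>n \<ge> 1\<close>. Cutting off at 0 keeps it from becoming negative should
    \<open>T n\<close> exceed \<open>(n / e\<^sup>2) ^ n\<close>.\<close>
  define \<epsilon> where "\<epsilon> n = max 0 (1 - root n (T n) / (real n / (exp 1)\<^sup>2))" for n
  have "((1 - \<epsilon> n) * (real n / (exp 1)\<^sup>2)) ^ n \<le> real (T n)" if "n \<ge> 1" for n
  proof -
    have "(1 - \<epsilon> n) * (real n / (exp 1)\<^sup>2) \<le> root n (T n)"
      using that by (simp add: \<epsilon>_def max_def field_simps)
    moreover have "0 \<le> 1 - \<epsilon> n"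
      using real_root_ge_zero[of "real (T n)" n] by (simp add: \<epsilon>_def)
    ultimately have "((1 - \<epsilon> n) * (real n / (exp 1)\<^sup>2)) ^ n \<le> root n (T n) ^ n"
      by (intro power_mono) auto
    then show ?thesis using that by simp
  qed
  moreover have "\<epsilon> \<longlonglongrightarrow> 0"
  proof (rule tendstoI)
    fix e :: real assume e: "e > 0"
    define \<delta> where "\<delta> = min (e / 2) (1 / 2)"
    have \<delta>: "0 < \<delta>" "\<delta> < 1" "\<delta> < e" using e by (auto simp: \<delta>_def)
    show "eventually (\<lambda>n. dist (\<epsilon> n) 0 < e) sequentially"
      using eventually_T_ge[OF \<delta>(1,2)] eventually_gt_at_top[of 0]
    proof eventually_elim
      case (elim n)
      have "(1 - \<delta>) * (real n / (exp 1)\<^sup>2) = root n (((1 - \<delta>) * (real n / (exp 1)\<^sup>2)) ^ n)"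
        using elim \<delta> by (simp add: real_root_power_cancel)
      also have "\<dots> \<le> root n (T n)" using elim by simp
      finally have "1 - \<delta> \<le> root n (T n) / (real n / (exp 1)\<^sup>2)"
        using elim by (subst pos_le_divide_eq) auto
      then show ?case using \<delta> e by (simp add: \<epsilon>_def)
    qed
  qed
  ultimately show ?thesis by blast
qed

end
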